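(* Let $p$ be a prime, $q$ a power of $p$, and $N\ge 3$ an odd integer. Let $B$ be the set of $(x,y,z)\in\mathbb{F}_{q^{2N}}^3$ satisfying $x^q+x=y^{q+1}$ and $y^{q^2}-y=z^{\frac{q^N+1}{q+1}}$ with $y\notin\mathbb{F}_{q^2}$, ordered as $Q_1,\dots,Q_n$. For a positive integer $l$, let $$V=\operatorname{Span}_{\mathbb{F}_{q^{2N}}}\Big\{x^iz^jy^\kappa:\ 0\le i\le q-2,\ 0\le j\le \tfrac{q^N+1}{q+1}-2,\ 0\le\kappa\le l\Big\}$$ and $C=\{(f(Q_1),\dots,f(Q_n)):f\in V\}$. Suppose $l<q^{N+2}+q^{N+1}-q-1$, $0<k<n$ for $k$ below, and that the right-hand side of the distance bound below is positive. Then $C$ is an $[n,k,d]$ linear code over $\mathbb{F}_{q^{2N}}$ with availability $2$ and locality $\big(q-1,\frac{q^N+1}{q+1}-1\big)$ (the recovery sets of the position of $(x,y,z)$ being the other points of $B$ with the same $(y,z)$, respectively the same $(x,y)$), where $$n=q^{2N+2}-q^{N+3}+q^{N+2}-q^3,\qquad k=\Big(\tfrac{q^N+1}{q+1}-1\Big)(q-1)(l+1),$$ $$d\ \ge\ n-l\,\frac{q(q^N+1)}{q+1}-\Big((q^N+1)(q-2)+q^3\Big(\tfrac{q^N+1}{q+1}-2\Big)\Big).$$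
   Context: This is the code $C(l\infty_y,B)$ on the generalized Giulietti–Korchmáros curve $\mathcal{C}_N$, the normalization of the intersection of $x^q+x=y^{q+1}$ and $y^{q^2}-y=z^{(q^N+1)/(q+1)}$, viewed as the fiber product over $\mathbb{P}^1_y$ of these two plane curves; $B$ consists of the $\mathbb{F}_{q^{2N}}$-rational points of $\mathcal{C}_N$ not lying over $\infty_y$ or over $y=a$ with $a\in\mathbb{F}_{q^2}$. A linear code has availability $2$ and locality $(r_1,r_2)$ if each position $i$ has two disjoint sets $A_{i1},A_{i2}$ of other positions with $|A_{ij}|=r_j$ such that the $i$-th entry of every codeword is a function of its entries on $A_{ij}$, for $j=1,2$. *)

theory Defs
  imports
    "Jordan_Normal_Form.VS_Connect"
    "HOL-Computational_Algebra.Primes"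
    "HOL-Library.Cardinality"
    "HOL-Library.FuncSet"
    "HOL-Library.Function_Algebras"
begin

definition hamming_dist :: "'a vec \<Rightarrow> 'a vec \<Rightarrow> nat" where
  "hamming_dist u v = card {i. i < dim_vec u \<and> u $ i \<noteq> v $ i}"

text \<open>The zero code gets the value \<open>Inf {} = 0\<close>.\<close>

definition min_distance :: "'a vec set \<Rightarrow> nat" where
  "min_distance C = Inf {hamming_dist u v | u v. u \<in> C \<and> v \<in> C \<and> u \<noteq> v}"

definition linear_code :: "nat \<Rightarrow> nat \<Rightarrow> nat \<Rightarrow> 'a::field vec set \<Rightarrow> bool" where
  "linear_code n k d C \<longleftrightarrow>
     subspace class_ring C (module_vec TYPE('a) n) \<and>
     vectorspace.dim class_ring ((module_vec TYPE('a) n)\<lparr>carrier := C\<rparr>) = k \<and>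
     min_distance C = d"

definition recovers :: "'a vec set \<Rightarrow> nat \<Rightarrow> nat set \<Rightarrow> bool" where
  "recovers C i A \<longleftrightarrow>
     (\<exists>\<phi>::(nat \<Rightarrow> 'a) \<Rightarrow> 'a. \<forall>c\<in>C. c $ i = \<phi> (restrict (\<lambda>j. c $ j) A))"

definition recovery_pair ::
  "nat \<Rightarrow> 'a vec set \<Rightarrow> nat \<Rightarrow> nat \<Rightarrow> nat \<Rightarrow> nat set \<Rightarrow> nat set \<Rightarrow> bool" where
  "recovery_pair n C r1 r2 i A1 A2 \<longleftrightarrow>
     A1 \<subseteq> {..<n} - {i} \<and> A2 \<subseteq> {..<n} - {i} \<and> A1 \<inter> A2 = {} \<and>
     card A1 = r1 \<and> card A2 = r2 \<and> recovers C i A1 \<and> recovers C i A2"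

definition availability_2_locality :: "nat \<Rightarrow> 'a vec set \<Rightarrow> nat \<Rightarrow> nat \<Rightarrow> bool" where
  "availability_2_locality n C r1 r2 \<longleftrightarrow> (\<forall>i<n. \<exists>A1 A2. recovery_pair n C r1 r2 i A1 A2)"


global_interpretation fun_vs: vector_space "\<lambda>(c::'a::field) (f::'b \<Rightarrow> 'a) P. c * f P"
  by unfold_locales (auto simp: fun_eq_iff algebra_simps)

text \<open>For odd \<open>N\<close> the division is exact.\<close>

definition gk_exp :: "nat \<Rightarrow> nat \<Rightarrow> nat" where
  "gk_exp q N = (q ^ N + 1) div (q + 1)"

text \<open>The subfield with \<open>Q\<close> elements of a finite field whose order is a power of \<open>Q\<close>.\<close>

definition subfield_of_order :: "nat \<Rightarrow> 'a::field set" where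
  "subfield_of_order Q = {a. a ^ Q = a}"

definition gk_points :: "nat \<Rightarrow> nat \<Rightarrow> ('a::field \<times> 'a \<times> 'a) set" where
  "gk_points q N = {(x, y, z).
     x ^ q + x = y ^ (q + 1) \<and>
     y ^ (q\<^sup>2) - y = z ^ gk_exp q N \<and>
     y \<notin> subfield_of_order (q\<^sup>2)}"

definition gk_space :: "nat \<Rightarrow> nat \<Rightarrow> nat \<Rightarrow> ('a::field \<times> 'a \<times> 'a \<Rightarrow> 'a) set" where
  "gk_space q N l = fun_vs.span
     {(\<lambda>(x, y, z). x ^ i * z ^ j * y ^ \<kappa>) | i j \<kappa>.
        i \<le> q - 2 \<and> j \<le> gk_exp q N - 2 \<and> \<kappa> \<le> l}"

definition gk_code ::
  "nat \<Rightarrow> nat \<Rightarrow> nat \<Rightarrow> nat \<Rightarrow> (nat \<Rightarrow> 'a::field \<times> 'a \<times> 'a) \<Rightarrow> 'a vec set" where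
  "gk_code q N l n Q = {vec n (\<lambda>i. f (Q i)) | f. f \<in> gk_space q N l}"

end

theory Submission
  imports Defs "HOL-Library.Product_Plus" "HOL-Number_Theory.Cong" "Jordan_Normal_Form.DL_Rank"
begin

text \<open>
  Number of points: \<open>w = y ^ q\<^sup>2 - y\<close> is a nonzero \<open>M\<close>-th power iff \<open>w ^ (q ^ N) = c * w\<close> for some \<open>c\<close> with
  \<open>c ^ (q + 1) = 1\<close>. For each of the \<open>q + 1\<close> values of \<open>c\<close>, the trace to the field with \<open>q\<^sup>2\<close> elements maps the
  \<open>q ^ N\<close> solutions \<open>w\<close> onto a line over the field with \<open>q\<close> elements, so \<open>q ^ (N - 1)\<close> of them have the form
  \<open>y ^ q\<^sup>2 - y\<close>, each for \<open>q\<^sup>2\<close> values of \<open>y\<close>. For these \<open>y\<close> the equation \<open>x ^ q + x = y ^ (q + 1)\<close> is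
  automatically solvable.

  Distance: give \<open>x\<close>, \<open>y\<close>, \<open>z\<close> the weights \<open>q ^ N + 1\<close>, \<open>q * M\<close>, \<open>q ^ 3\<close>. Both equations of the curve are
  homogeneous up to terms of smaller weight, and the monomials with exponent of \<open>x\<close> below \<open>q\<close> and exponent
  of \<open>z\<close> below \<open>M\<close> have distinct weights. Hence a function with leading weight \<open>\<rho>\<close> has at most \<open>\<rho>\<close> zeros,
  which also gives the dimension.

  Recovery: on the points with fixed \<open>(y, z)\<close> a codeword is a polynomial in \<open>x\<close> of degree at most \<open>q - 2\<close>,
  and there are \<open>q\<close> such points; similarly in \<open>z\<close>.
\<close>

section \<open>Points of the curve\<close>

lemma card_eq_sum_card_fibres:
  assumes "finite A" "finite B" "f ` A \<subseteq> B"
  shows "card A = (\<Sum>v\<in>B. card {x \<in> A. f x = v})"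
proof -
  have "card A = (\<Sum>x\<in>A. 1)" by simp
  also have "\<dots> = (\<Sum>v\<in>B. \<Sum>x | x \<in> A \<and> f x = v. 1)"
    by (rule sum.group[symmetric]) (use assms in auto)
  finally show ?thesis by simp
qed

text \<open>Two upper bounds whose product is the cardinality of the domain are both attained. With the degree
  bounds below this determines kernels and images of linearized polynomials without group theory.\<close>

lemma fibres_exact:
  assumes "finite A" "finite B" "f ` A \<subseteq> B" "card B \<le> b"
    and le: "\<And>v. v \<in> B \<Longrightarrow> card {x \<in> A. f x = v} \<le> a"
    and "card A = a * b" "a > 0"
  shows "card B = b" and "v \<in> B \<Longrightarrow> card {x \<in> A. f x = v} = a"
proof -
  note sum_eq = card_eq_sum_card_fibres[OF assms(1-3)]
  have "a * b \<le> a * card B"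
    using sum_bounded_above[of B "\<lambda>v. card {x \<in> A. f x = v}" a] le sum_eq assms(6)
    by (simp add: mult.commute)
  then show B: "card B = b"
    using \<open>a > 0\<close> \<open>card B \<le> b\<close> by auto
  show "card {x \<in> A. f x = v} = a" if "v \<in> B"
  proof (rule ccontr)
    assume "card {x \<in> A. f x = v} \<noteq> a"
    with le[OF that] have "card {x \<in> A. f x = v} < a" by simp
    with that have "(\<Sum>v\<in>B. card {x \<in> A. f x = v}) < (\<Sum>v\<in>B. a)"
      by (intro sum_strict_mono_ex1 assms) (use le in auto)
    with sum_eq B assms(6) show False by (simp add: mult.commute)
  qed
qed

lemma card_roots_le:
  fixes P :: "'a::idom poly"
  assumes "coeff P d \<noteq> 0" "degree P \<le> d" "\<And>x. x \<in> A \<Longrightarrow> poly P x = 0"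
  shows "card A \<le> d"
proof -
  have "P \<noteq> 0" using assms(1) by auto
  then have "card A \<le> card {x. poly P x = 0}"
    using assms(3) by (intro card_mono poly_roots_finite) auto
  also have "\<dots> \<le> d"
    using card_poly_roots_bound[OF \<open>P \<noteq> 0\<close>] assms(2) by simp
  finally show ?thesis .
qed

lemma card_power_fibre_le:
  fixes v :: "'a::idom"
  assumes "d > 0"
  shows "card {x. x ^ d = v} \<le> d"
  by (rule card_roots_le[where P = "monom 1 d - [:v:]"])
     (use assms in \<open>auto simp: poly_monom coeff_pCons split: nat.splits intro!: degree_diff_le degree_monom_le\<close>)

text \<open>As \<open>q \<ge> 2\<close>, the exponents \<open>q ^ i\<close> are distinct and
  positive, so neither the other terms nor the constant \<open>v\<close> disturb the top coefficient
  \<open>c k\<close>.\<close>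

lemma card_linearized_fibre_le:
  fixes c :: "nat \<Rightarrow> 'a::idom"
  assumes "q \<ge> 2" "c k \<noteq> 0"
  shows "card {x. (\<Sum>i\<le>k. c i * x ^ (q ^ i)) = v} \<le> q ^ k"
proof (rule card_roots_le[where P = "(\<Sum>i\<le>k. monom (c i) (q ^ i)) - [:v:]"])
  have "q ^ k > 0" using assms by simp
  then show "coeff ((\<Sum>i\<le>k. monom (c i) (q ^ i)) - [:v:]) (q ^ k) \<noteq> 0"
    using assms by (auto simp: coeff_sum coeff_pCons sum.delta' split: nat.splits)
  show "degree ((\<Sum>i\<le>k. monom (c i) (q ^ i)) - [:v:]) \<le> q ^ k"
    using assms
    by (intro degree_diff_le degree_sum_le) (auto intro!: order.trans[OF degree_monom_le] power_increasing)
qed (auto simp: poly_sum poly_monom)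

text \<open>Multiplication by \<open>x\<close> permutes the nonzero elements, so it leaves their
  product unchanged.\<close>

lemma finite_field_power_card_minus_one:
  fixes x :: "'a::{field,finite}"
  assumes "x \<noteq> 0"
  shows "x ^ (CARD('a) - 1) = 1"
proof -
  have "(\<Prod>y\<in>UNIV-{0}. x * y) = (\<Prod>y\<in>UNIV-{0}. y)"
    by (rule prod.reindex_bij_witness[of _ "\<lambda>y. y / x" "\<lambda>y. x * y"]) (use assms in auto)
  then have "x ^ (CARD('a) - 1) * \<Prod>(UNIV-{0}) = \<Prod>(UNIV-{0::'a})"
    by (simp add: prod.distrib)
  then show ?thesis by simp
qed

lemma finite_field_power_card:
  fixes x :: "'a::{field,finite}"
  shows "x ^ CARD('a) = x"
proof (cases "x = 0")
  case False
  then show ?thesis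
    using finite_field_power_card_minus_one[OF False] power_eq_if[of x "CARD('a)"] by simp
qed simp

text \<open>The \<open>m\<close>-th power map sends the \<open>m * r\<close> nonzero elements into
  the at most \<open>r\<close> roots of \<open>w ^ r = 1\<close>, with fibres of size at most
  \<open>m\<close>; hence both bounds are equalities.\<close>

lemma power_map_fibres:
  assumes "m * r = CARD('a::{field,finite}) - 1" "CARD('a) \<ge> 2"
  shows "card {w::'a. w ^ r = 1} = r"
    and "w ^ r = 1 \<Longrightarrow> card {z::'a. z ^ m = w} = m"
proof -
  have pos: "m > 0" "r > 0" using assms by (auto intro: Nat.gr0I)
  have fib: "card {x \<in> UNIV - {0}. x ^ m = v} \<le> m" for v :: 'a
    by (rule order.trans[OF card_mono card_power_fibre_le[OF pos(1), of v]]) auto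
  have sub: "(\<lambda>z. z ^ m) ` (UNIV - {0}) \<subseteq> {w::'a. w ^ r = 1}"
    using finite_field_power_card_minus_one[where 'a='a] assms(1) by (auto simp flip: power_mult)
  have crd: "card (UNIV - {0::'a}) = m * r"
    using assms(1) by simp
  note * = fibres_exact[OF _ _ sub card_power_fibre_le[OF pos(2)] fib crd pos(1)]
  show "card {w::'a. w ^ r = 1} = r"
    using *(1) by simp
  assume w: "w ^ r = 1"
  then have "{x \<in> UNIV - {0}. x ^ m = w} = {z. z ^ m = w}"
    using pos by (auto simp: power_0_left)
  with *(2)[of w] w show "card {z::'a. z ^ m = w} = m" by simp
qed

lemma sum_lessThan_add:
  fixes f :: "nat \<Rightarrow> 'a::comm_monoid_add"
  shows "(\<Sum>i<a + b. f i) = (\<Sum>i<a. f i) + (\<Sum>i<b. f (a + i))"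
  by (induction b) (simp_all add: ac_simps)

lemma sum_split_parity:
  fixes f :: "nat \<Rightarrow> 'a::comm_monoid_add"
  shows "(\<Sum>i\<le>2 * m. f i) = (\<Sum>j\<le>m. f (2 * j)) + (\<Sum>j<m. f (2 * j + 1))"
  by (induction m) (simp_all add: ac_simps)

lemma alternating_telescope:
  fixes g :: "nat \<Rightarrow> 'a::comm_ring_1"
  shows "(\<Sum>i<n. (-1) ^ i * (g i + g (Suc i))) = g 0 - (-1) ^ n * g n"
  by (induction n) (simp_all add: algebra_simps)

text \<open>That \<open>q\<close> is a power of the characteristic is recorded as
  \<open>frob_add\<close>. The exponent \<open>M\<close> is given by a product, which keeps
  \<open>div\<close> out of the computations.\<close>

locale gk_field =
  fixes q N M :: nat and ty :: "'a::{field,finite} itself"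
  assumes q_ge_2: "q \<ge> 2"
    and frob_add: "(a + b :: 'a) ^ q = a ^ q + b ^ q"
    and N_ge_3: "N \<ge> 3" and odd_N: "odd N"
    and card_field: "CARD('a) = q ^ (2 * N)"
    and M_mult: "M * (q + 1) = q ^ N + 1"
begin

section \<open>Frobenius powers and exponent arithmetic\<close>

lemma q_pos: "q > 0" using q_ge_2 by simp

lemma pow_frob_add: "(a + b :: 'a) ^ (q ^ i) = a ^ (q ^ i) + b ^ (q ^ i)"
  by (induction i) (simp_all add: power_mult frob_add mult.commute[of q])

lemma pow_frob_diff: "(a - b :: 'a) ^ (q ^ i) = a ^ (q ^ i) - b ^ (q ^ i)"
  using pow_frob_add[of "a - b" b i] by (simp add: algebra_simps)

lemma pow_frob_zero: "(0::'a) ^ (q ^ i) = 0"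
  using q_pos by simp

lemma pow_frob_sum: "(sum f A :: 'a) ^ (q ^ i) = (\<Sum>x\<in>A. f x ^ (q ^ i))"
  by (induction A rule: infinite_finite_induct) (simp_all add: pow_frob_add pow_frob_zero)

lemma pow_frob_pow_frob: "((a::'a) ^ (q ^ i)) ^ (q ^ j) = a ^ (q ^ (i + j))"
  by (simp add: power_mult power_add flip: power_mult)

lemma pow_frob_2N: "(a::'a) ^ (q ^ (2 * N)) = a"
  using finite_field_power_card[of a] card_field by simp

text \<open>Makes \<open>M - 2\<close> an honest difference in the exponent ranges. It holds because
  \<open>q ^ N\<close> is at least \<open>4 * q\<close>.\<close>

lemma M_ge_3: "M \<ge> 3"
proof (rule ccontr)
  assume "\<not> M \<ge> 3"
  then have "M * (q + 1) \<le> 2 * (q + 1)" by (intro mult_right_mono) auto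
  then have 1: "q ^ N + 1 \<le> 2 * (q + 1)" unfolding M_mult .
  have "2 * (2 * q) \<le> q * (q * q)"
    using q_ge_2 by (intro mult_mono) auto
  also have "\<dots> = q ^ 3" by (simp add: power3_eq_cube)
  also have "\<dots> \<le> q ^ N" using q_pos N_ge_3 by (intro power_increasing) auto
  finally show False using 1 q_ge_2 by simp
qed

lemma qN_mult: "(q ^ N - 1) * (q ^ N + 1) = CARD('a) - 1"
proof -
  have "q ^ (2 * N) = q ^ N * q ^ N" by (simp add: mult_2 power_add)
  then show ?thesis by (simp add: card_field algebra_simps)
qed

text \<open>The cofactor of \<open>M\<close> in the order of the multiplicative group: raising to it
  tests whether a nonzero element is an \<open>M\<close>-th power.\<close>

lemma M_mult_rest: "M * ((q ^ N - 1) * (q + 1)) = CARD('a) - 1"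
proof -
  have "M * ((q ^ N - 1) * (q + 1)) = (q ^ N - 1) * (M * (q + 1))" by (simp only: ac_simps)
  also have "\<dots> = (q ^ N - 1) * (q ^ N + 1)" by (simp only: M_mult)
  also have "\<dots> = CARD('a) - 1" by (rule qN_mult)
  finally show ?thesis .
qed

lemma card_ge_2: "CARD('a) \<ge> 2"
  using card_field q_ge_2 self_le_power[of q "2 * N"] N_ge_3 by simp

lemma power_fixed_even:
  assumes "(a::'a) ^ (q\<^sup>2) = a"
  shows "a ^ (q ^ (2 * j)) = a"
proof (induction j)
  case (Suc j)
  have "a ^ (q ^ (2 * Suc j)) = (a ^ (q ^ (2 * j))) ^ (q\<^sup>2)"
    by (simp add: power2_eq_square ac_simps flip: power_mult)
  then show ?case by (simp only: Suc.IH assms)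
qed simp

lemma power_fixed_odd:
  assumes "(a::'a) ^ (q\<^sup>2) = a" "odd i"
  shows "a ^ (q ^ i) = a ^ q"
proof -
  obtain j where "i = 2 * j + 1" using assms(2) by (rule oddE)
  then have "a ^ (q ^ i) = (a ^ (q ^ (2 * j))) ^ q" by (simp add: mult.commute flip: power_mult)
  then show ?thesis by (simp only: power_fixed_even[OF assms(1)])
qed

section \<open>Images of \<open>x ^ q + x\<close> and \<open>y ^ (q\<^sup>2) - y\<close>\<close>

definition alt_trace :: "'a \<Rightarrow> 'a" where
  "alt_trace u = (\<Sum>i<2 * N. (-1) ^ i * u ^ (q ^ i))"

text \<open>The sum telescopes, and its ends cancel because \<open>2 * N\<close> is even and the
  \<open>q ^ (2 * N)\<close>-th power is the identity.\<close>

lemma alt_trace_image: "alt_trace (x ^ q + x) = 0"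
proof -
  have "alt_trace (x ^ q + x) = (\<Sum>i<2 * N. (-1) ^ i * (x ^ (q ^ i) + x ^ (q ^ Suc i)))"
    unfolding alt_trace_def by (simp add: pow_frob_add ac_simps flip: power_mult)
  also have "\<dots> = 0"
    using pow_frob_2N[of x] alternating_telescope[of "\<lambda>i. x ^ (q ^ i)" "2 * N"] by simp
  finally show ?thesis .
qed

text \<open>A form of additive Hilbert 90. Fibres have at most \<open>q\<close> elements and the
  image lies in the kernel of \<open>alt_trace\<close>, which has at most
  \<open>q ^ (2 * N - 1)\<close>; the product of these bounds is the order of the field.\<close>

lemma card_add_frob_fibre:
  assumes "alt_trace u = 0"
  shows "card {x::'a. x ^ q + x = u} = q"
proof -
  have fib: "card {x::'a. x ^ q + x = v} \<le> q" for v
    using card_linearized_fibre_le[OF q_ge_2, of "\<lambda>_. 1" 1 v] by (simp add: add.commute)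
  have "card {u. (\<Sum>i\<le>2 * N - 1. (-1) ^ i * u ^ (q ^ i)) = (0::'a)} \<le> q ^ (2 * N - 1)"
    by (rule card_linearized_fibre_le[OF q_ge_2]) simp
  moreover have "{..2 * N - 1} = {..<2 * N}" using N_ge_3 by auto
  ultimately have B: "card {u. alt_trace u = 0} \<le> q ^ (2 * N - 1)"
    by (simp add: alt_trace_def)
  have crd: "card (UNIV :: 'a set) = q * q ^ (2 * N - 1)"
    using card_field N_ge_3 power_eq_if[of q "2 * N"] by simp
  have "card {x \<in> UNIV. x ^ q + x = u} = q"
    by (rule fibres_exact(2)[OF _ _ _ B _ crd q_pos])
       (use fib assms in \<open>auto simp: alt_trace_image\<close>)
  then show ?thesis by simp
qed

text \<open>The trace to the subfield with \<open>q\<^sup>2\<close> elements.\<close>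

definition trace2 :: "'a \<Rightarrow> 'a" where
  "trace2 w = (\<Sum>j<N. w ^ (q ^ (2 * j)))"

lemma trace2_frob2: "trace2 (w ^ (q\<^sup>2)) = trace2 w"
proof -
  have "trace2 (w ^ (q\<^sup>2)) = (\<Sum>j<N. w ^ (q ^ (2 * Suc j)))"
    unfolding trace2_def by (simp add: power2_eq_square ac_simps flip: power_mult)
  also have "\<dots> = (\<Sum>j<Suc N. w ^ (q ^ (2 * j))) - w"
    by (subst sum.lessThan_Suc_shift) simp
  also have "\<dots> = trace2 w"
    unfolding trace2_def using pow_frob_2N by simp
  finally show ?thesis .
qed

lemma trace2_image: "trace2 (y ^ (q\<^sup>2) - y) = 0"
proof -
  have "trace2 (y ^ (q\<^sup>2) - y) = trace2 (y ^ (q\<^sup>2)) - trace2 y"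
    unfolding trace2_def by (simp add: pow_frob_diff sum_subtractf)
  then show ?thesis by (simp add: trace2_frob2)
qed

text \<open>Additive Hilbert 90 for this trace, by the same count.\<close>

lemma card_diff_frob2_fibre:
  assumes "trace2 w = 0"
  shows "card {y::'a. y ^ (q\<^sup>2) - y = w} = q\<^sup>2"
proof -
  have fib: "card {y::'a. y ^ (q\<^sup>2) - y = v} \<le> q\<^sup>2" for v
    using card_linearized_fibre_le[OF q_ge_2, of "\<lambda>i. if i = 0 then -1 else if i = 1 then 0 else 1" 2 v]
    by (simp add: numeral_2_eq_2)
  have N2: "{..N - 1} = {..<N}" using N_ge_3 by auto
  \<comment> \<open>Zero coefficients at odd indices pad \<open>trace2\<close> to a sum over
    consecutive powers of \<open>q\<close>.\<close>
  have "card {u. (\<Sum>i\<le>2 * (N - 1). (if even i then 1 else 0) * u ^ (q ^ i)) = (0::'a)} \<le> q ^ (2 * (N - 1))"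
    by (rule card_linearized_fibre_le[OF q_ge_2]) simp
  then have B: "card {u. trace2 u = 0} \<le> q ^ (2 * (N - 1))"
    unfolding sum_split_parity trace2_def N2[symmetric] by simp
  have "2 * N = 2 + 2 * (N - 1)" using N_ge_3 by simp
  then have crd: "card (UNIV :: 'a set) = q\<^sup>2 * q ^ (2 * (N - 1))"
    unfolding card_field by (metis power_add)
  have "card {y \<in> UNIV. y ^ (q\<^sup>2) - y = w} = q\<^sup>2"
    by (rule fibres_exact(2)[OF _ _ _ B _ crd])
       (use fib assms q_pos in \<open>auto simp: trace2_image\<close>)
  then show ?thesis by simp
qed

section \<open>Eigenspaces of the \<open>q ^ N\<close>-th power map and their traces\<close>

lemma unity_root_facts:
  assumes "(c::'a) ^ (q + 1) = 1"
  shows "c * c ^ q = 1" "c ^ (q\<^sup>2) = c" "c ^ (q ^ N + 1) = 1"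
proof -
  show 1: "c * c ^ q = 1" using assms by simp
  \<comment> \<open>Both \<open>c\<close> and \<open>(c ^ q) ^ q\<close> are inverse to
    \<open>c ^ q\<close>.\<close>
  then have "c ^ q * (c ^ q) ^ q = 1" by (metis power_mult_distrib power_one)
  with 1 have "c ^ q * (c ^ q) ^ q = c ^ q * c" by (simp add: mult.commute)
  moreover have "c ^ q \<noteq> 0" using 1 by auto
  ultimately have "(c ^ q) ^ q = c" by (metis mult_left_cancel)
  then show "c ^ (q\<^sup>2) = c" by (simp add: power2_eq_square power_mult)
  show "c ^ (q ^ N + 1) = 1"
    using assms unfolding M_mult[symmetric] mult.commute[of M] power_mult by simp
qed

text \<open>The nonzero solutions are the \<open>(q ^ N - 1)\<close>-th roots of \<open>c\<close>,
  present in full number because \<open>c ^ (q ^ N + 1) = 1\<close>.\<close>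

lemma card_eigenspace:
  assumes "(c::'a) ^ (q + 1) = 1"
  shows "card {w. w ^ (q ^ N) = c * w} = q ^ N"
proof -
  have qN: "q ^ N = Suc (q ^ N - 1)" using q_pos by simp
  have "q ^ N > 1" using q_ge_2 N_ge_3 by (intro one_less_power) auto
  have "card {w. w ^ (q ^ N - 1) = c} = q ^ N - 1"
    by (rule power_map_fibres(2)[OF qN_mult card_ge_2 unity_root_facts(3)[OF assms]])
  moreover have "{w. w ^ (q ^ N) = c * w} = insert 0 {w. w ^ (q ^ N - 1) = c}"
    by (subst qN, subst power_Suc) (auto simp: q_pos)
  moreover have "0 \<notin> {w. w ^ (q ^ N - 1) = c}"
    using \<open>q ^ N > 1\<close> q_pos assms by (auto simp: power_0_left)
  ultimately show ?thesis using qN by simp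
qed

text \<open>The eigenvalue equation folds the terms with \<open>2 * j > N\<close> back to odd
  exponents below \<open>N\<close>, lowering the degree of the trace to \<open>q ^ (N - 1)\<close>.
  The second part confines its values to the roots of a polynomial of degree
  \<open>q\<close>.\<close>

lemma trace2_eigen:
  assumes c: "(c::'a) ^ (q + 1) = 1" and w: "w ^ (q ^ N) = c * w"
  shows "trace2 w = (\<Sum>i\<le>N - 1. (if even i then 1 else c ^ q) * w ^ (q ^ i))"
    and "trace2 w ^ q = c * trace2 w"
proof -
  obtain m where m: "N = 2 * m + 1" using odd_N by (rule oddE)
  have "w ^ (q ^ (2 * (Suc m + j))) = c ^ q * w ^ (q ^ (2 * j + 1))" for j
  proof -
    have e: "2 * (Suc m + j) = N + (2 * j + 1)" using m by simp
    have "w ^ (q ^ (2 * (Suc m + j))) = (w ^ (q ^ N)) ^ (q ^ (2 * j + 1))"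
      unfolding e pow_frob_pow_frob ..
    also have "\<dots> = c ^ (q ^ (2 * j + 1)) * w ^ (q ^ (2 * j + 1))"
      by (simp only: w power_mult_distrib)
    also have "c ^ (q ^ (2 * j + 1)) = c ^ q"
      by (rule power_fixed_odd[OF unity_root_facts(2)[OF c]]) simp
    finally show ?thesis .
  qed
  note * = this
  have "trace2 w = (\<Sum>j<Suc m + m. w ^ (q ^ (2 * j)))"
    unfolding trace2_def using m by (simp add: mult_2)
  also have "\<dots> = (\<Sum>j\<le>m. w ^ (q ^ (2 * j))) + (\<Sum>j<m. w ^ (q ^ (2 * (Suc m + j))))"
    by (simp only: sum_lessThan_add lessThan_Suc_atMost)
  also have "\<dots> = (\<Sum>i\<le>N - 1. (if even i then 1 else c ^ q) * w ^ (q ^ i))"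
    unfolding * m add_diff_cancel_right' sum_split_parity by simp
  finally show "trace2 w = (\<Sum>i\<le>N - 1. (if even i then 1 else c ^ q) * w ^ (q ^ i))" .
  have "trace2 w ^ (q\<^sup>2) = trace2 (w ^ (q\<^sup>2))"
    unfolding trace2_def pow_frob_sum by (simp add: mult.commute flip: power_mult)
  then have "trace2 w ^ (q\<^sup>2) = trace2 w" by (simp add: trace2_frob2)
  \<comment> \<open>The trace lies in the field with \<open>q\<^sup>2\<close> elements, where odd
    iterates of the \<open>q\<close>-th power map coincide.\<close>
  then have "trace2 w ^ q = trace2 w ^ (q ^ N)"
    using power_fixed_odd odd_N by simp
  also have "\<dots> = trace2 (w ^ (q ^ N))"
    unfolding trace2_def pow_frob_sum by (simp add: mult.commute flip: power_mult)
  also have "\<dots> = c * trace2 w"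
  proof -
    have "c ^ (q ^ (2 * j)) = c" for j
      by (rule power_fixed_even[OF unity_root_facts(2)[OF c]])
    then show ?thesis unfolding trace2_def w by (simp add: power_mult_distrib sum_distrib_left)
  qed
  finally show "trace2 w ^ q = c * trace2 w" .
qed


text \<open>The trace sends \<open>q ^ N\<close> elements to at most \<open>q\<close> values with
  fibres of size at most \<open>q ^ (N - 1)\<close>, so both bounds are attained.\<close>

lemma card_eigenspace_trace_zero:
  assumes c: "(c::'a) ^ (q + 1) = 1"
  shows "card {w. w ^ (q ^ N) = c * w \<and> trace2 w = 0} = q ^ (N - 1)"
proof -
  let ?V = "{w. w ^ (q ^ N) = c * w}"
  have B: "card {t::'a. t ^ q = c * t} \<le> q"
    using card_linearized_fibre_le[OF q_ge_2, of "\<lambda>i. if i = 0 then - c else 1" 1 0] by simp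
  have fib: "card {w \<in> ?V. trace2 w = t} \<le> q ^ (N - 1)" for t
  proof -
    have "card {w. (\<Sum>i\<le>N - 1. (if even i then 1 else c ^ q) * w ^ (q ^ i)) = t} \<le> q ^ (N - 1)"
      \<comment> \<open>The leading coefficient is 1 because \<open>N - 1\<close> is even.\<close>
      by (rule card_linearized_fibre_le[OF q_ge_2]) (use odd_N in auto)
    moreover have "{w \<in> ?V. trace2 w = t}
        \<subseteq> {w. (\<Sum>i\<le>N - 1. (if even i then 1 else c ^ q) * w ^ (q ^ i)) = t}"
      using trace2_eigen(1)[OF c] by auto
    ultimately show ?thesis by (meson card_mono finite order.trans)
  qed
  have crd: "card ?V = q ^ (N - 1) * q"
    unfolding card_eigenspace[OF c] using N_ge_3 by (simp add: power_eq_if)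
  have "card {w \<in> ?V. trace2 w = 0} = q ^ (N - 1)"
    by (rule fibres_exact(2)[OF _ _ _ B fib crd]) (use trace2_eigen(2)[OF c] q_pos in auto)
  then show ?thesis by simp
qed

text \<open>The nonzero \<open>M\<close>-th powers.\<close>

definition good :: "'a set" where
  "good = {w. w ^ ((q ^ N - 1) * (q + 1)) = 1}"

lemma good_nonzero: "w \<in> good \<Longrightarrow> w \<noteq> 0"
  using q_ge_2 N_ge_3 one_less_power[of q N] by (auto simp: good_def power_0_left)

lemma good_eigen:
  assumes "w \<in> good"
  shows "(w ^ (q ^ N - 1)) ^ (q + 1) = 1" "w ^ (q ^ N) = w ^ (q ^ N - 1) * w"
proof -
  show "(w ^ (q ^ N - 1)) ^ (q + 1) = 1"
    using assms unfolding good_def power_mult by simp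
  show "w ^ (q ^ N) = w ^ (q ^ N - 1) * w" using q_pos power_minus_mult[of "q ^ N" w] by simp
qed

text \<open>For nonzero \<open>w\<close> the scalar is forced to be \<open>w ^ (q ^ N - 1)\<close>,
  so distinct eigenspaces meet only in 0.\<close>

lemma good_iff: "w \<in> good \<longleftrightarrow> w \<noteq> 0 \<and> (\<exists>c. c ^ (q + 1) = 1 \<and> w ^ (q ^ N) = c * w)"
proof
  assume "w \<in> good"
  then show "w \<noteq> 0 \<and> (\<exists>c. c ^ (q + 1) = 1 \<and> w ^ (q ^ N) = c * w)"
    using good_nonzero good_eigen by blast
next
  assume "w \<noteq> 0 \<and> (\<exists>c. c ^ (q + 1) = 1 \<and> w ^ (q ^ N) = c * w)"
  then obtain c where c: "w \<noteq> 0" "c ^ (q + 1) = 1" "w ^ (q ^ N) = c * w" by auto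
  have "w ^ (q ^ N - 1) * w = c * w" using c(3) q_pos power_minus_mult[of "q ^ N" w] by simp
  then have "w ^ (q ^ N - 1) = c" using c(1) by simp
  then show "w \<in> good" using c(2) unfolding good_def power_mult by simp
qed

lemma card_good_trace_zero: "card {w \<in> good. trace2 w = 0} = (q + 1) * (q ^ (N - 1) - 1)"
proof -
  let ?K = "\<lambda>c. {w. w ^ (q ^ N) = c * w \<and> trace2 w = 0} - {0}"
  let ?U = "{c::'a. c ^ (q + 1) = 1}"
  have t0: "trace2 0 = 0" unfolding trace2_def using q_pos by simp
  have "{w \<in> good. trace2 w = 0} = (\<Union>c\<in>?U. ?K c)"
    by (auto simp: good_iff)
  moreover have "card (\<Union>c\<in>?U. ?K c) = (\<Sum>c\<in>?U. card (?K c))"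
    by (rule card_UN_disjoint) auto
  ultimately have "card {w \<in> good. trace2 w = 0} = (\<Sum>c\<in>?U. card (?K c))"
    by (simp only:)
  also have "\<dots> = (\<Sum>c\<in>?U. q ^ (N - 1) - 1)"
    using card_eigenspace_trace_zero t0 q_pos by (intro sum.cong) (auto simp: card_Diff_singleton)
  also have "\<dots> = card ?U * (q ^ (N - 1) - 1)" by simp
  also have "\<dots> = (q + 1) * (q ^ (N - 1) - 1)"
    using power_map_fibres(1)[where 'a='a, of "M * (q ^ N - 1)" "q + 1"] M_mult_rest card_ge_2
    by (simp only: mult.assoc)
  finally show ?thesis .
qed

lemma card_good_ordinates:
  "card {y. y ^ (q\<^sup>2) - y \<in> good} = (q + 1) * (q ^ (N - 1) - 1) * q\<^sup>2"
proof -
  let ?A = "{y. y ^ (q\<^sup>2) - y \<in> good}" and ?B = "{w \<in> good. trace2 w = 0}"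
  have "card ?A = (\<Sum>w\<in>?B. card {y \<in> ?A. y ^ (q\<^sup>2) - y = w})"
    by (rule card_eq_sum_card_fibres) (auto simp: trace2_image)
  also have "\<dots> = (\<Sum>w\<in>?B. q\<^sup>2)"
  proof (rule sum.cong)
    fix w assume w: "w \<in> ?B"
    then have "{y \<in> ?A. y ^ (q\<^sup>2) - y = w} = {y. y ^ (q\<^sup>2) - y = w}" by auto
    then show "card {y \<in> ?A. y ^ (q\<^sup>2) - y = w} = q\<^sup>2"
      using card_diff_frob2_fibre w by simp
  qed simp
  finally show ?thesis by (simp add: card_good_trace_zero)
qed

text \<open>Writing \<open>w = y ^ q\<^sup>2 - y\<close> and \<open>w ^ (q ^ N) = c * w\<close>, the element \<open>b = y ^ (q ^ N) - c * y\<close> lies in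
  the field with \<open>q\<^sup>2\<close> elements and satisfies \<open>c * b ^ q = - b\<close>; this makes the alternating sum telescope
  to \<open>y * (b + c * b ^ q)\<close>.\<close>

lemma alt_trace_norm_eq_0:
  assumes "y ^ (q\<^sup>2) - y \<in> good"
  shows "alt_trace (y ^ (q + 1)) = 0"
proof -
  define w where "w = y ^ (q\<^sup>2) - y"
  define c where "c = w ^ (q ^ N - 1)"
  define b where "b = y ^ (q ^ N) - c * y"
  have w: "w \<in> good" using assms by (simp add: w_def)
  have c: "c ^ (q + 1) = 1" "w ^ (q ^ N) = c * w"
    using good_eigen[OF w] by (simp_all add: c_def)
  note cf = unity_root_facts[OF c(1)]
  have cN: "c ^ (q ^ N) = c ^ q" by (rule power_fixed_odd[OF cf(2) odd_N])
  have yN: "y ^ (q ^ N) = c * y + b" by (simp add: b_def)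
  have "b ^ (q\<^sup>2) - b = w ^ (q ^ N) - c * w"
  proof -
    have "b ^ (q\<^sup>2) = (y ^ (q ^ N)) ^ (q\<^sup>2) - c * y ^ (q\<^sup>2)"
      by (simp add: b_def pow_frob_diff power_mult_distrib cf(2))
    also have "(y ^ (q ^ N)) ^ (q\<^sup>2) = (y ^ (q\<^sup>2)) ^ (q ^ N)"
      by (simp add: mult.commute flip: power_mult)
    finally show ?thesis by (simp add: w_def pow_frob_diff b_def algebra_simps)
  qed
  then have b2: "b ^ (q\<^sup>2) = b" using c(2) by simp
  have bN: "b ^ (q ^ N) = b ^ q" by (rule power_fixed_odd[OF b2 odd_N])
  \<comment> \<open>Two applications of the \<open>q ^ N\<close>-th power return \<open>y\<close>,
    so \<open>b ^ (q ^ N)\<close> can be computed from the definition of \<open>b\<close>;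
    multiplied by \<open>c\<close> it is \<open>- b\<close>.\<close>
  have "(y ^ (q ^ N)) ^ (q ^ N) = y"
    using pow_frob_2N[of y] by (simp add: pow_frob_pow_frob mult_2)
  then have "b ^ (q ^ N) = y - c ^ q * y ^ (q ^ N)"
    by (simp add: b_def pow_frob_diff power_mult_distrib cN)
  then have "c * b ^ q = c * y - (c * c ^ q) * y ^ (q ^ N)"
    by (simp add: bN right_diff_distrib mult.assoc)
  then have cb: "c * b ^ q = - b" by (simp only: cf(1)) (simp add: b_def)
  then have "c ^ q * (c * b ^ q) = - (c ^ q * b)" by simp
  moreover have "c ^ q * (c * b ^ q) = (c * c ^ q) * b ^ q" by (simp only: ac_simps)
  ultimately have cb': "c ^ q * b = - (b ^ q)" using cf(1) by simp
  define u where "u = y ^ (q + 1)"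
  define g where "g i = (b * y) ^ (q ^ i)" for i
  \<comment> \<open>The norm of \<open>b\<close> to the field with \<open>q\<close> elements, fixed
    by every Frobenius power.\<close>
  define h where "h = b * b ^ q"
  have hq: "h ^ (q ^ i) = h" for i
  proof (induction i)
    case (Suc i)
    have "h ^ q = h" using b2 by (simp add: h_def power_mult_distrib power2_eq_square power_mult)
    then show ?case using Suc by (simp add: power_mult)
  qed simp
  have "u ^ (q ^ N) = (y ^ (q ^ N)) ^ (q + 1)"
    unfolding u_def power_mult[symmetric] by (simp only: mult.commute)
  also have "\<dots> = (c * y + b) * (c * y + b) ^ q"
    unfolding yN by simp
  also have "\<dots> = (c * c ^ q) * u + (c ^ q * b) * y ^ q + (c * b ^ q) * y + h"
    by (simp add: frob_add power_mult_distrib u_def h_def algebra_simps)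
  also have "\<dots> = u - (g 0 + g 1 - h)"
  proof -
    have "b ^ q * y ^ q = g 1" "b * y = g 0" by (simp_all add: g_def power_mult_distrib)
    then show ?thesis unfolding cf(1) cb cb' by simp
  qed
  finally have "u - u ^ (q ^ N) = g 0 + g 1 - h" by simp
  then have step: "u ^ (q ^ i) - u ^ (q ^ (N + i)) = g i + g (Suc i) - h" for i
  proof -
    have "u ^ (q ^ i) - u ^ (q ^ (N + i)) = (u - u ^ (q ^ N)) ^ (q ^ i)"
      by (simp add: pow_frob_diff pow_frob_pow_frob)
    also have "\<dots> = (g 0 + g 1 - h) ^ (q ^ i)" using \<open>u - u ^ (q ^ N) = g 0 + g 1 - h\<close> by simp
    also have "\<dots> = g i + g (Suc i) - h"
      by (simp add: pow_frob_diff pow_frob_add hq g_def mult.commute flip: power_mult)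
    finally show ?thesis .
  qed
  have alt1: "(\<Sum>i<N. (-1) ^ i * h) = h"
  proof -
    obtain m where "N = 2 * m + 1" using odd_N by (rule oddE)
    moreover have "(\<Sum>i<2 * m. (-1) ^ i * h) = 0" by (induction m) simp_all
    ultimately show ?thesis by simp
  qed
  \<comment> \<open>As \<open>N\<close> is odd, the terms at \<open>i\<close> and
    \<open>N + i\<close> carry opposite signs and pair up as in \<open>step\<close>.\<close>
  have "alt_trace u = (\<Sum>i<N. (-1) ^ i * u ^ (q ^ i)) + (\<Sum>i<N. (-1) ^ (N + i) * u ^ (q ^ (N + i)))"
    unfolding alt_trace_def mult_2 sum_lessThan_add ..
  also have "\<dots> = (\<Sum>i<N. (-1) ^ i * (u ^ (q ^ i) - u ^ (q ^ (N + i))))"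
    using odd_N by (simp add: power_add sum_negf sum_subtractf right_diff_distrib)
  also have "\<dots> = (\<Sum>i<N. (-1) ^ i * (g i + g (Suc i))) - (\<Sum>i<N. (-1) ^ i * h)"
    unfolding step right_diff_distrib sum_subtractf ..
  also have "\<dots> = g 0 + g N - h"
    unfolding alternating_telescope alt1 using odd_N by simp
  \<comment> \<open>Here \<open>g N = b ^ q * (c * y + b)\<close>, whose last part cancels
    \<open>h\<close>.\<close>
  also have "\<dots> = y * (b + c * b ^ q)"
    by (simp add: g_def power_mult_distrib bN yN h_def algebra_simps)
  also have "\<dots> = 0" by (simp add: cb)
  finally show ?thesis by (simp add: u_def)
qed

section \<open>Fibres over the ordinates and the number of points\<close>

lemma good_if_power:
  assumes "z ^ M \<noteq> 0"
  shows "z ^ M \<in> good"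
proof -
  have "z \<noteq> 0" using assms M_ge_3 by auto
  then have "z ^ (M * ((q ^ N - 1) * (q + 1))) = 1"
    unfolding M_mult_rest by (rule finite_field_power_card_minus_one)
  then show ?thesis unfolding good_def by (simp only: power_mult mem_Collect_eq)
qed

lemma card_z_fibre:
  assumes "y ^ (q\<^sup>2) - y \<in> good"
  shows "card {z. y ^ (q\<^sup>2) - y = z ^ M} = M"
  using power_map_fibres(2)[OF M_mult_rest card_ge_2, of "y ^ (q\<^sup>2) - y"] assms
  unfolding good_def eq_commute[of "y ^ (q\<^sup>2) - y"] by blast

lemma card_x_fibre:
  assumes "y ^ (q\<^sup>2) - y \<in> good"
  shows "card {x. x ^ q + x = y ^ (q + 1)} = q"
  by (rule card_add_frob_fibre[OF alt_trace_norm_eq_0[OF assms]])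

lemma gk_exp_eq: "gk_exp q N = M"
  unfolding gk_exp_def M_mult[symmetric] by (rule nonzero_mult_div_cancel_right) simp

text \<open>Off the field with \<open>q\<^sup>2\<close> elements the common value of
  \<open>y ^ (q\<^sup>2) - y\<close> and \<open>z ^ M\<close> is a nonzero \<open>M\<close>-th
  power. This form fits the fibre counts.\<close>

lemma gk_points_iff:
  "(x, y, z) \<in> gk_points q N \<longleftrightarrow>
    y ^ (q\<^sup>2) - y \<in> good \<and> x ^ q + x = y ^ (q + 1) \<and> y ^ (q\<^sup>2) - y = z ^ M"
proof -
  have "y ^ (q\<^sup>2) \<noteq> y \<longleftrightarrow> y ^ (q\<^sup>2) - y \<in> good" if "y ^ (q\<^sup>2) - y = z ^ M"
    using good_if_power[of z] good_nonzero[of "y ^ (q\<^sup>2) - y"] unfolding that[symmetric] by auto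
  then show ?thesis
    unfolding gk_points_def gk_exp_eq subfield_of_order_def by blast
qed

text \<open>For fixed \<open>y\<close> the equations for \<open>x\<close> and \<open>z\<close> are
  independent, so the fibre is a product.\<close>

lemma card_gk_points:
  "card (gk_points q N :: ('a \<times> 'a \<times> 'a) set) = (q + 1) * (q ^ (N - 1) - 1) * q\<^sup>2 * (q * M)"
proof -
  let ?Y = "{y. y ^ (q\<^sup>2) - y \<in> good}"
  let ?F = "\<lambda>y. {x. x ^ q + x = y ^ (q + 1)} \<times> {z. y ^ (q\<^sup>2) - y = z ^ M}"
  have "bij_betw (\<lambda>(y, x, z). (x, y, z)) (Sigma ?Y ?F) (gk_points q N :: ('a \<times> 'a \<times> 'a) set)"
    by (rule bij_betwI[where g = "\<lambda>(x, y, z). (y, x, z)"]) (auto simp: gk_points_iff)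
  then have "card (gk_points q N :: ('a \<times> 'a \<times> 'a) set) = card (Sigma ?Y ?F)"
    by (simp add: bij_betw_same_card)
  also have "\<dots> = (\<Sum>y\<in>?Y. card (?F y))"
    by (rule card_SigmaI) auto
  also have "\<dots> = (\<Sum>y\<in>?Y. q * M)"
    using card_x_fibre card_z_fibre by (intro sum.cong) (auto simp: card_cartesian_product)
  finally show ?thesis by (simp add: card_good_ordinates)
qed

lemma card_gk_points_int:
  "int (card (gk_points q N :: ('a \<times> 'a \<times> 'a) set)) =
    int q ^ (2 * N + 2) - int q ^ (N + 3) + int q ^ (N + 2) - int q ^ 3"
proof -
  have "int M * (int q + 1) = int q ^ N + 1"
    using arg_cong[OF M_mult, of int] by (simp add: algebra_simps)
  moreover have "int (q ^ (N - 1) - 1) = int q ^ (N - 1) - 1" using q_pos by (simp add: of_nat_diff)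
  moreover have "int (card (gk_points q N :: ('a \<times> 'a \<times> 'a) set)) =
      (int M * (int q + 1)) * int (q ^ (N - 1) - 1) * int q ^ 3"
    unfolding card_gk_points of_nat_mult by (simp add: power2_eq_square power3_eq_cube)
  ultimately have "int (card (gk_points q N :: ('a \<times> 'a \<times> 'a) set)) =
      (int q ^ N + 1) * (int q ^ (N - 1) - 1) * int q ^ 3" by simp
  also have "int q ^ (N - 1) * int q ^ 3 = int q ^ (N + 2)"
    using N_ge_3 by (simp flip: power_add)
  then have "(int q ^ N + 1) * (int q ^ (N - 1) - 1) * int q ^ 3
      = (int q ^ N + 1) * (int q ^ (N + 2) - int q ^ 3)" by (simp add: algebra_simps)
  also have "\<dots> = int q ^ (N + (N + 2)) - int q ^ (N + 3) + int q ^ (N + 2) - int q ^ 3"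
    by (simp only: power_add[of _ N "N + 2"] power_add[of _ N 3]) (simp add: left_diff_distrib right_diff_distrib distrib_right)
  also have "N + (N + 2) = 2 * N + 2" by simp
  finally show ?thesis .
qed

end

section \<open>Zeros of functions on the curve\<close>

lemma sum_fun_apply: "(\<Sum>a\<in>A. f a) x = (\<Sum>a\<in>A. f a x :: 'a::comm_monoid_add)"
  by (induction A rule: infinite_finite_induct) auto

text \<open>Translation by \<open>\<rho>\<close> embeds the members of \<open>H\<close> up to
  \<open>m - \<rho>\<close> into those up to \<open>m\<close>, and only \<open>\<rho>\<close>
  numbers lie between the two limits.\<close>

lemma card_semigroup_gaps_le:
  fixes H :: "nat set"
  assumes "\<rho> \<in> H" and add: "\<And>a b. a \<in> H \<Longrightarrow> b \<in> H \<Longrightarrow> a + b \<in> H" and "\<rho> \<le> m"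
  shows "card {h \<in> H. h \<le> m \<and> \<not> (\<exists>h'\<in>H. h = \<rho> + h')} \<le> \<rho>"
proof -
  let ?H = "\<lambda>m. {h \<in> H. h \<le> m}"
  have "{h \<in> H. h \<le> m \<and> \<not> (\<exists>h'\<in>H. h = \<rho> + h')} = ?H m - (+) \<rho> ` ?H (m - \<rho>)"
    using \<open>\<rho> \<le> m\<close> by auto
  moreover have "card (?H m - (+) \<rho> ` ?H (m - \<rho>)) = card (?H m) - card ((+) \<rho> ` ?H (m - \<rho>))"
    using assms by (intro card_Diff_subset) auto
  ultimately have "card {h \<in> H. h \<le> m \<and> \<not> (\<exists>h'\<in>H. h = \<rho> + h')}
      = card (?H m) - card ((+) \<rho> ` ?H (m - \<rho>))" by (simp only:)
  also have "card ((+) \<rho> ` ?H (m - \<rho>)) = card (?H (m - \<rho>))"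
    by (intro card_image) auto
  also have "card (?H m) \<le> card (?H (m - \<rho>) \<union> {m - \<rho><..m})"
    by (intro card_mono) auto
  then have "card (?H m) - card (?H (m - \<rho>)) \<le> \<rho>"
    using card_Un_le[of "?H (m - \<rho>)" "{m - \<rho><..m}"] assms(3) by simp
  finally show ?thesis .
qed

text \<open>If a combination with leading weight \<open>\<rho>\<close> vanishes on \<open>Z\<close>, then on \<open>Z\<close> every monomial whose weight is
  \<open>\<rho>\<close> plus a weight is a combination of monomials of smaller weight, so one monomial for each remaining
  weight suffices to span all functions on \<open>Z\<close>.\<close>

lemma order_function_zero_bound:
  fixes wt :: "'i::plus \<Rightarrow> nat" and \<mu> :: "'i \<Rightarrow> 'b \<Rightarrow> 'a::field"
  assumes wt_add: "\<And>a b. wt (a + b) = wt a + wt b"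
    and mult: "\<And>a b P. \<mu> (a + b) P = \<mu> a P * \<mu> b P"
    and same: "\<And>a b. wt a = wt b \<Longrightarrow> \<mu> a - \<mu> b \<in> fun_vs.span (\<mu> ` {t. wt t < wt a})"
    and spanning: "finite T" "\<And>P. P \<in> Z \<Longrightarrow> (\<lambda>P'. if P' = P then 1 else 0) \<in> fun_vs.span (\<mu> ` T)"
    and A: "finite A" "inj_on wt A" "\<exists>a\<in>A. c a \<noteq> 0" "\<And>a. a \<in> A \<Longrightarrow> wt a \<le> w"
    and zero: "\<And>P. (\<Sum>a\<in>A. c a * \<mu> a P) = 0"
    and Z: "finite Z"
  shows "card Z \<le> w"
proof -
  define A' where "A' = {a \<in> A. c a \<noteq> 0}"
  have A': "finite A'" "A' \<noteq> {}" using A by (auto simp: A'_def)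
  then have "Max (wt ` A') \<in> wt ` A'" by (intro Max_in) auto
  then obtain a1 where a1: "a1 \<in> A'" "wt a1 = Max (wt ` A')" by auto
  define \<rho> where "\<rho> = wt a1"
  \<comment> \<open>Injectivity of \<open>wt\<close> on \<open>A\<close> makes the leading monomial
    unique.\<close>
  have lt: "wt a < \<rho>" if "a \<in> A' - {a1}" for a
  proof -
    have "wt a \<le> \<rho>" using that A' a1 by (simp add: \<rho>_def)
    moreover have "wt a \<noteq> \<rho>"
      using that a1(1) inj_onD[OF A(2), of a a1] by (auto simp: \<rho>_def A'_def)
    ultimately show ?thesis by simp
  qed
  have lead: "\<mu> a1 P = (\<Sum>a\<in>A' - {a1}. - (c a / c a1) * \<mu> a P)" for P
  proof -
    have "0 = (\<Sum>a\<in>A'. c a * \<mu> a P)"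
      unfolding A'_def using A(1) by (subst zero[of P, symmetric], intro sum.mono_neutral_right) auto
    also have "\<dots> = c a1 * \<mu> a1 P + (\<Sum>a\<in>A' - {a1}. c a * \<mu> a P)"
      using A' a1 by (intro sum.remove)
    finally have "c a1 * \<mu> a1 P = - (\<Sum>a\<in>A' - {a1}. c a * \<mu> a P)"
      by (simp add: eq_neg_iff_add_eq_0)
    then have "\<mu> a1 P = - (\<Sum>a\<in>A' - {a1}. c a * \<mu> a P) / c a1"
      using a1(1) unfolding A'_def by (subst nonzero_eq_divide_eq) (simp_all add: mult.commute)
    then show ?thesis by (simp add: sum_divide_distrib sum_negf)
  qed
  define H where "H = range wt"
  define sel where "sel h = (SOME a. wt a = h)" for h
  have sel: "wt (sel (wt a)) = wt a" for a
    unfolding sel_def by (rule someI) (rule refl)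
  \<comment> \<open>Large enough to cover all monomials indexed by \<open>T\<close>, and at least
    \<open>\<rho>\<close>.\<close>
  define m where "m = \<rho> + (\<Sum>t\<in>T. wt t)"
  define K where "K = {h \<in> H. h \<le> m \<and> \<not> (\<exists>h'\<in>H. h = \<rho> + h')}"
  have K: "card K \<le> \<rho>" unfolding K_def
    by (rule card_semigroup_gaps_le) (auto simp: H_def \<rho>_def m_def simp flip: wt_add)
  let ?W = "(\<lambda>h. \<mu> (sel h)) ` K"
  have mono_span: "\<mu> a \<in> fun_vs.span ?W" if "wt a \<le> m" for a
    using that
  proof (induction "wt a" arbitrary: a rule: less_induct)
    case less
    have low: "fun_vs.span (\<mu> ` {t. wt t < wt a}) \<subseteq> fun_vs.span ?W"
      by (rule fun_vs.span_minimal) (use less in auto)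
    show ?case
    proof (cases "\<exists>b. wt a = \<rho> + wt b")
      case True
      then obtain b where b: "wt a = \<rho> + wt b" ..
      \<comment> \<open>The relation for the leading monomial, multiplied by
        \<open>\<mu> b\<close>.\<close>
      have "\<mu> (a1 + b) = (\<Sum>a\<in>A' - {a1}. (\<lambda>P. - (c a / c a1) * \<mu> (a + b) P))"
        by (rule ext) (simp add: sum_fun_apply mult lead sum_distrib_right mult.assoc)
      also have "\<dots> \<in> fun_vs.span (\<mu> ` {t. wt t < wt a})"
        by (intro fun_vs.span_sum fun_vs.span_scale fun_vs.span_base)
           (use lt in \<open>auto simp: wt_add b\<close>)
      finally have "\<mu> (a1 + b) \<in> fun_vs.span (\<mu> ` {t. wt t < wt a})" .
      moreover have "\<mu> a - \<mu> (a1 + b) \<in> fun_vs.span (\<mu> ` {t. wt t < wt a})"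
        by (rule same) (simp add: wt_add b \<rho>_def)
      ultimately have "\<mu> a \<in> fun_vs.span (\<mu> ` {t. wt t < wt a})"
        using fun_vs.span_add by fastforce
      then show ?thesis using low by blast
    next
      case False
      then have "wt a \<in> K" using less.prems by (auto simp: K_def H_def)
      then have "\<mu> (sel (wt a)) \<in> fun_vs.span ?W" by (intro fun_vs.span_base) auto
      moreover have "\<mu> a - \<mu> (sel (wt a)) \<in> fun_vs.span ?W"
        using same[of a "sel (wt a)"] sel low by auto
      ultimately show ?thesis using fun_vs.span_add by fastforce
    qed
  qed
  let ?\<delta> = "\<lambda>P P'. if P' = P then 1 else (0::'a)"
  have "fun_vs.span (\<mu> ` T) \<subseteq> fun_vs.span ?W"
  proof (rule fun_vs.span_minimal)
    show "\<mu> ` T \<subseteq> fun_vs.span ?W"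
      using mono_span spanning(1) member_le_sum[of _ T wt]
      by (auto simp: m_def intro!: trans_le_add2)
  qed auto
  then have sub: "?\<delta> ` Z \<subseteq> fun_vs.span ?W" using spanning(2) by blast
  have inj: "inj_on ?\<delta> Z"
    by (rule inj_onI) (metis one_neq_zero)
  \<comment> \<open>Independent indicators inside the span of \<open>?W\<close> force
    \<open>card Z \<le> card ?W\<close>.\<close>
  have "fun_vs.independent (?\<delta> ` Z)"
  proof (rule fun_vs.independent_if_scalars_zero)
    fix u v
    assume s: "(\<Sum>x\<in>?\<delta> ` Z. (\<lambda>P. u x * x P)) = 0" and "v \<in> ?\<delta> ` Z"
    then obtain P where P: "P \<in> Z" "v = ?\<delta> P" by auto
    have "0 = (\<Sum>x\<in>?\<delta> ` Z. (\<lambda>P. u x * x P)) P" unfolding s by simp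
    also have "\<dots> = (\<Sum>P'\<in>Z. u (?\<delta> P') * ?\<delta> P' P)"
      unfolding sum_fun_apply by (subst sum.reindex[OF inj]) simp
    also have "\<dots> = (\<Sum>P'\<in>Z. if P' = P then u (?\<delta> P) else 0)"
      by (intro sum.cong) auto
    also have "\<dots> = u v" using Z P by simp
    finally show "u v = 0" by simp
  qed (use Z in simp)
  then have "card (?\<delta> ` Z) \<le> card ?W"
    using fun_vs.independent_span_bound[of ?W "?\<delta> ` Z"] sub by (simp add: K_def)
  also have "card ?W \<le> card K" by (rule card_image_le) (simp add: K_def)
  finally have "card Z \<le> \<rho>" using K by (simp add: card_image[OF inj])
  also have "\<rho> \<le> w" using A(4) a1(1) by (simp add: \<rho>_def A'_def)
  finally show ?thesis .
qed

fun gk_mono :: "nat \<times> nat \<times> nat \<Rightarrow> 'a::field \<times> 'a \<times> 'a \<Rightarrow> 'a" where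
  "gk_mono (i, j, \<kappa>) (x, y, z) = x ^ i * z ^ j * y ^ \<kappa>"

lemma gk_mono_add: "gk_mono (a + b) P = gk_mono a P * gk_mono b P"
  by (cases a; cases b; cases P) (simp add: power_add)

text \<open>The polynomial \<open>1 - (x - a) ^ (CARD('a) - 1)\<close> works; the fixed summation
  range lets indicators in several coordinates be multiplied.\<close>

lemma ex_indicator_poly:
  "\<exists>p :: 'a::{field,finite} poly. \<forall>x. (\<Sum>i\<le>CARD('a). coeff p i * x ^ i) = (if x = a then 1 else 0)"
proof -
  have card2: "CARD('a) \<ge> 2"
    using card_mono[of UNIV "{0, 1::'a}"] by simp
  let ?p = "1 - [:- a, 1:] ^ (CARD('a) - 1)"
  have deg: "degree ?p \<le> CARD('a)"
    using degree_power_le[of "[:- a, 1:]" "CARD('a) - 1"] by (intro degree_diff_le) auto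
  have "(\<Sum>i\<le>CARD('a). coeff ?p i * x ^ i) = (if x = a then 1 else 0)" for x
  proof -
    have "(\<Sum>i\<le>n. coeff p i * x ^ i) = poly p x" if "degree p \<le> n" for p and n :: nat
      unfolding poly_altdef using that
      by (intro sum.mono_neutral_right) (auto simp: coeff_eq_0)
    from this[OF deg] have "(\<Sum>i\<le>CARD('a). coeff ?p i * x ^ i) = poly ?p x" .
    also have "\<dots> = (if x = a then 1 else 0)"
      using card2 finite_field_power_card_minus_one[of "x - a"] by (auto simp: power_0_left)
    finally show ?thesis .
  qed
  then show ?thesis by blast
qed

section \<open>Weights and reduction of monomials on the curve\<close>

context gk_field
begin

text \<open>The pole orders of \<open>x\<close>, \<open>z\<close>, \<open>y\<close> at the point at infinity.\<close>

fun wt :: "nat \<times> nat \<times> nat \<Rightarrow> nat" where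
  "wt (i, j, \<kappa>) = i * ((q + 1) * M) + j * q ^ 3 + \<kappa> * (q * M)"

lemma coprime_q_M: "coprime q M"
proof -
  have "coprime q (q ^ N + 1)"
  proof (rule coprimeI)
    fix d assume d: "d dvd q" "d dvd q ^ N + 1"
    then have "d dvd q ^ N" using N_ge_3 by (intro dvd_power_le[of d q 1 N, simplified]) auto
    then show "d dvd 1" using d(2) dvd_add_right_iff by blast
  qed
  then show ?thesis unfolding M_mult[symmetric] by (simp only: coprime_mult_right_iff)
qed

text \<open>Modulo \<open>M\<close> the weight determines \<open>j\<close>, since
  \<open>q ^ 3\<close> is coprime to \<open>M\<close>. After cancelling \<open>M\<close>, reduction
  modulo \<open>q\<close> determines \<open>i\<close>, and then \<open>\<kappa>\<close>
  follows.\<close>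

lemma wt_inj_reduced:
  assumes eq: "wt (i, j, \<kappa>) = wt (i', j', \<kappa>')" and lt: "i < q" "i' < q" "j < M" "j' < M"
  shows "(i, j, \<kappa>) = (i', j', \<kappa>')"
proof -
  have form: "wt (i, j, \<kappa>) = j * q ^ 3 + (i * (q + 1) + \<kappa> * q) * M" for i j \<kappa>
    by (simp add: algebra_simps)
  have eq': "j * q ^ 3 + (i * (q + 1) + \<kappa> * q) * M = j' * q ^ 3 + (i' * (q + 1) + \<kappa>' * q) * M"
    using eq unfolding form .
  then have "(j * q ^ 3) mod M = (j' * q ^ 3) mod M"
    by (metis mod_mult_self1)
  moreover have "coprime (q ^ 3) M" using coprime_q_M by simp
  ultimately have "[j = j'] (mod M)"
    using cong_mult_rcancel_nat by (simp add: cong_def)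
  with lt have j: "j = j'" by (simp add: cong_def)
  with eq' have "(i * (q + 1) + \<kappa> * q) * M = (i' * (q + 1) + \<kappa>' * q) * M"
    by (simp only: add_left_cancel)
  then have "i * (q + 1) + \<kappa> * q = i' * (q + 1) + \<kappa>' * q"
    using M_ge_3 unfolding mult_cancel2 by auto
  then have "i + (i + \<kappa>) * q = i' + (i' + \<kappa>') * q"
    by (simp add: algebra_simps)
  then have "(i + (i + \<kappa>) * q) mod q = (i' + (i' + \<kappa>') * q) mod q" by simp
  with lt have i: "i = i'" by simp
  with \<open>i + (i + \<kappa>) * q = i' + (i' + \<kappa>') * q\<close> j q_pos show ?thesis by simp
qed

lemma wt_add: "wt (a + b) = wt a + wt b"
  by (cases a; cases b) (simp add: algebra_simps)

context
  fixes Z :: "('a \<times> 'a \<times> 'a) set"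
  assumes Z: "Z \<subseteq> gk_points q N"
begin

text \<open>Vanishing off \<open>Z\<close> models functions on \<open>Z\<close> by total functions
  and keeps monomials multiplicative.\<close>

definition mono_on_set :: "nat \<times> nat \<times> nat \<Rightarrow> 'a \<times> 'a \<times> 'a \<Rightarrow> 'a" where
  "mono_on_set a P = (if P \<in> Z then gk_mono a P else 0)"

abbreviation low :: "nat \<Rightarrow> ('a \<times> 'a \<times> 'a \<Rightarrow> 'a) set" where
  "low w \<equiv> fun_vs.span (mono_on_set ` {t. wt t < w})"

text \<open>The curve equation replaces \<open>x ^ q\<close> by \<open>y ^ (q + 1)\<close>, of equal
  weight, minus the lighter \<open>x\<close>.\<close>

lemma reduce_x: "mono_on_set (i + q, j, \<kappa>) - mono_on_set (i, j, \<kappa> + (q + 1)) \<in> low (wt (i + q, j, \<kappa>))"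
proof -
  have "mono_on_set (i + q, j, \<kappa>) P - mono_on_set (i, j, \<kappa> + (q + 1)) P
      = - 1 * mono_on_set (i + 1, j, \<kappa>) P" for P
  proof (cases "P \<in> Z")
    case True
    obtain x y z where P: "P = (x, y, z)" by (cases P)
    have "x ^ q + x = y ^ (q + 1)" using True Z P gk_points_iff by blast
    then have "x ^ q = y ^ (q + 1) - x" by (simp add: eq_diff_eq)
    then show ?thesis using True unfolding P mono_on_set_def
      by (simp only: if_True gk_mono.simps power_add) (simp add: algebra_simps)
  qed (simp add: mono_on_set_def)
  then have *: "mono_on_set (i + q, j, \<kappa>) - mono_on_set (i, j, \<kappa> + (q + 1))
      = (\<lambda>P. - 1 * mono_on_set (i + 1, j, \<kappa>) P)" by (intro ext) simp
  show ?thesis unfolding *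
    by (intro fun_vs.span_scale fun_vs.span_base imageI)
       (use q_ge_2 M_ge_3 in \<open>simp add: add_mult_distrib\<close>)
qed

text \<open>Likewise \<open>z ^ M\<close> and \<open>y ^ (q\<^sup>2)\<close> have equal weight and
  differ by the lighter \<open>y\<close>.\<close>

lemma reduce_z: "mono_on_set (i, j + M, \<kappa>) - mono_on_set (i, j, \<kappa> + q\<^sup>2) \<in> low (wt (i, j + M, \<kappa>))"
proof -
  have "mono_on_set (i, j + M, \<kappa>) P - mono_on_set (i, j, \<kappa> + q\<^sup>2) P
      = - 1 * mono_on_set (i, j, \<kappa> + 1) P" for P
  proof (cases "P \<in> Z")
    case True
    obtain x y z where P: "P = (x, y, z)" by (cases P)
    have "y ^ (q\<^sup>2) - y = z ^ M" using True Z P gk_points_iff by blast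
    then have "z ^ M = y ^ (q\<^sup>2) - y" by simp
    then show ?thesis using True unfolding P mono_on_set_def
      by (simp only: if_True gk_mono.simps power_add) (simp add: algebra_simps)
  qed (simp add: mono_on_set_def)
  then have *: "mono_on_set (i, j + M, \<kappa>) - mono_on_set (i, j, \<kappa> + q\<^sup>2)
      = (\<lambda>P. - 1 * mono_on_set (i, j, \<kappa> + 1) P)" by (intro ext) simp
  have "1 < q * q" using q_ge_2 less_1_mult[of q q] by linarith
  then have "q * M * 1 < q * M * (q * q)" using q_ge_2 M_ge_3
    by (intro mult_strict_left_mono) auto
  moreover have "wt (i, j, \<kappa> + 1) = wt (i, j, \<kappa>) + q * M * 1"
    "wt (i, j + M, \<kappa>) = wt (i, j, \<kappa>) + q * M * (q * q)"
    by (simp_all add: algebra_simps power3_eq_cube)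
  ultimately have "(i, j, \<kappa> + 1) \<in> {t. wt t < wt (i, j + M, \<kappa>)}"
    by (simp only: mem_Collect_eq add_less_cancel_left)
  then show ?thesis unfolding *
    by (intro fun_vs.span_scale fun_vs.span_base imageI)
qed

text \<open>Each reduction keeps the weight and lowers \<open>i + j\<close> by moving exponents into
  \<open>y\<close>.\<close>

lemma ex_reduced:
  "\<exists>i' j' \<kappa>'. i' < q \<and> j' < M \<and> wt (i', j', \<kappa>') = wt (i, j, \<kappa>)
    \<and> mono_on_set (i, j, \<kappa>) - mono_on_set (i', j', \<kappa>') \<in> low (wt (i, j, \<kappa>))"
proof (induction "i + j" arbitrary: i j \<kappa> rule: less_induct)
  case less
  have step: ?case if lt: "i0 + j0 < i + j" and w: "wt (i0, j0, \<kappa>0) = wt (i, j, \<kappa>)"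
    and d: "mono_on_set (i, j, \<kappa>) - mono_on_set (i0, j0, \<kappa>0) \<in> low (wt (i, j, \<kappa>))" for i0 j0 \<kappa>0
  proof -
    obtain i' j' \<kappa>' where *: "i' < q" "j' < M" "wt (i', j', \<kappa>') = wt (i0, j0, \<kappa>0)"
      "mono_on_set (i0, j0, \<kappa>0) - mono_on_set (i', j', \<kappa>') \<in> low (wt (i0, j0, \<kappa>0))"
      using less[OF lt] by blast
    have "mono_on_set (i, j, \<kappa>) - mono_on_set (i', j', \<kappa>') \<in> low (wt (i, j, \<kappa>))"
      using fun_vs.span_add[OF d *(4)[unfolded w]] by simp
    moreover have "wt (i', j', \<kappa>') = wt (i, j, \<kappa>)" using *(3) w by (rule trans)
    ultimately show ?thesis using *(1,2) by blast
  qed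
  consider "i \<ge> q" | "j \<ge> M" | "i < q" "j < M" by linarith
  then show ?case
  proof cases
    case 1
    then obtain i0 where "i = i0 + q" by (metis le_add_diff_inverse2)
    then show ?thesis
      using reduce_x[of i0 j \<kappa>] q_pos by (intro step[of i0 j "\<kappa> + (q + 1)"]) (auto simp: algebra_simps)
  next
    case 2
    then obtain j0 where "j = j0 + M" by (metis le_add_diff_inverse2)
    then show ?thesis
      using reduce_z[of i j0 \<kappa>] M_ge_3
      by (intro step[of i j0 "\<kappa> + q\<^sup>2"]) (auto simp: algebra_simps power3_eq_cube power2_eq_square)
  next
    case 3
    then show ?thesis using fun_vs.span_zero by (intro exI[of _ i] exI[of _ j] exI[of _ \<kappa>]) simp
  qed
qed

text \<open>Monomials of equal weight reduce to the same reduced monomial, by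
  \<open>wt_inj_reduced\<close>.\<close>

lemma mono_diff_low:
  assumes "wt a = wt b"
  shows "mono_on_set a - mono_on_set b \<in> low (wt a)"
proof -
  obtain i j \<kappa> i' j' \<kappa>' where ab: "a = (i, j, \<kappa>)" "b = (i', j', \<kappa>')" by (cases a; cases b)
  obtain i1 j1 \<kappa>1 where 1: "i1 < q" "j1 < M" "wt (i1, j1, \<kappa>1) = wt a"
    "mono_on_set a - mono_on_set (i1, j1, \<kappa>1) \<in> low (wt a)"
    using ex_reduced[of i j \<kappa>] unfolding ab by blast
  obtain i2 j2 \<kappa>2 where 2: "i2 < q" "j2 < M" "wt (i2, j2, \<kappa>2) = wt b"
    "mono_on_set b - mono_on_set (i2, j2, \<kappa>2) \<in> low (wt b)"
    using ex_reduced[of i' j' \<kappa>'] unfolding ab by blast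
  have "wt (i1, j1, \<kappa>1) = wt (i2, j2, \<kappa>2)" using 1(3) 2(3) assms by (simp del: wt.simps)
  then have e: "(i1, j1, \<kappa>1) = (i2, j2, \<kappa>2)"
    using 1(1,2) 2(1,2) by (intro wt_inj_reduced)
  have "mono_on_set a - mono_on_set b = (mono_on_set a - mono_on_set (i1, j1, \<kappa>1))
      - (mono_on_set b - mono_on_set (i2, j2, \<kappa>2))" unfolding e by simp
  also have "\<dots> \<in> low (wt a)"
    using 1(4) 2(4) unfolding assms by (rule fun_vs.span_diff)
  finally show ?thesis .
qed

text \<open>Expand the product of one-variable indicators of the three coordinates.\<close>

lemma indicator_in_span:
  assumes "P0 \<in> Z"
  shows "(\<lambda>P. if P = P0 then 1 else 0)
    \<in> fun_vs.span (mono_on_set ` ({..CARD('a)} \<times> {..CARD('a)} \<times> {..CARD('a)}))"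
proof -
  obtain x0 y0 z0 where P0: "P0 = (x0, y0, z0)" by (cases P0)
  let ?I = "{..CARD('a)}"
  obtain f where f: "\<forall>x. (\<Sum>i\<in>?I. coeff f i * x ^ i) = (if x = x0 then 1 else 0)"
    using ex_indicator_poly[of x0] by blast
  obtain g where g: "\<forall>x. (\<Sum>i\<in>?I. coeff g i * x ^ i) = (if x = z0 then 1 else 0)"
    using ex_indicator_poly[of z0] by blast
  obtain h where h: "\<forall>x. (\<Sum>i\<in>?I. coeff h i * x ^ i) = (if x = y0 then 1 else 0)"
    using ex_indicator_poly[of y0] by blast
  let ?F = "\<Sum>(i, j, \<kappa>)\<in>?I \<times> ?I \<times> ?I.
      (\<lambda>P. (coeff f i * coeff g j * coeff h \<kappa>) * mono_on_set (i, j, \<kappa>) P)"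
  have "?F P = (if P = P0 then 1 else 0)" for P
  proof (cases "P \<in> Z")
    case True
    obtain x y z where P: "P = (x, y, z)" by (cases P)
    have "?F P = (\<Sum>(i, j, \<kappa>)\<in>?I \<times> ?I \<times> ?I.
        (coeff f i * x ^ i) * (coeff g j * z ^ j) * (coeff h \<kappa> * y ^ \<kappa>))"
      unfolding sum_fun_apply using True by (intro sum.cong) (auto simp: P mono_on_set_def)
    also have "\<dots> = (\<Sum>i\<in>?I. \<Sum>j\<in>?I. \<Sum>\<kappa>\<in>?I.
        (coeff f i * x ^ i) * (coeff g j * z ^ j) * (coeff h \<kappa> * y ^ \<kappa>))"
      by (simp only: sum.cartesian_product)
    also have "\<dots> = (\<Sum>i\<in>?I. coeff f i * x ^ i) * (\<Sum>j\<in>?I. coeff g j * z ^ j) * (\<Sum>\<kappa>\<in>?I. coeff h \<kappa> * y ^ \<kappa>)"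
      by (subst sum_product, simp only: sum_distrib_right, simp only: sum_distrib_left)
    also have "\<dots> = (if P = P0 then 1 else 0)"
      unfolding f[rule_format] g[rule_format] h[rule_format] P P0 by simp
    finally show ?thesis .
  next
    case False
    then have "P \<noteq> P0" using assms by auto
    with False show ?thesis
      unfolding sum_fun_apply by (simp add: mono_on_set_def case_prod_beta)
  qed
  then have "?F = (\<lambda>P. if P = P0 then 1 else 0)" by (rule ext)
  moreover have "?F \<in> fun_vs.span (mono_on_set ` (?I \<times> ?I \<times> ?I))"
    unfolding case_prod_beta by (intro fun_vs.span_sum fun_vs.span_scale fun_vs.span_base imageI) auto
  ultimately show ?thesis by (simp only:)
qed

end

text \<open>The exponent box lies in the reduced range, so its weights are distinct; the bound is
  the weight of its largest corner.\<close>

lemma gk_zero_bound: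
  assumes Z: "Z \<subseteq> (gk_points q N :: ('a \<times> 'a \<times> 'a) set)"
    and nz: "\<exists>a\<in>{..q - 2} \<times> {..M - 2} \<times> {..l}. c a \<noteq> 0"
    and zero: "\<And>P. P \<in> Z \<Longrightarrow> (\<Sum>a\<in>{..q - 2} \<times> {..M - 2} \<times> {..l}. c a * gk_mono a P) = 0"
  shows "card Z \<le> l * (q * M) + ((q ^ N + 1) * (q - 2) + q ^ 3 * (M - 2))"
proof (rule order_function_zero_bound[where wt = wt and \<mu> = "mono_on_set Z" and c = c
      and A = "{..q - 2} \<times> {..M - 2} \<times> {..l}"])
  show "wt (a + b) = wt a + wt b" for a b by (rule wt_add)
  show "mono_on_set Z (a + b) P = mono_on_set Z a P * mono_on_set Z b P" for a b P
    by (simp add: mono_on_set_def[OF Z] gk_mono_add)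
  show "mono_on_set Z a - mono_on_set Z b \<in> fun_vs.span (mono_on_set Z ` {t. wt t < wt a})"
    if "wt a = wt b" for a b by (rule mono_diff_low[OF Z that])
  show "(\<lambda>P'. if P' = P then 1 else 0)
      \<in> fun_vs.span (mono_on_set Z ` ({..CARD('a)} \<times> {..CARD('a)} \<times> {..CARD('a)}))"
    if "P \<in> Z" for P by (rule indicator_in_span[OF Z that])
  show "inj_on wt ({..q - 2} \<times> {..M - 2} \<times> {..l})"
  proof (rule inj_onI)
    fix a b assume "a \<in> {..q - 2} \<times> {..M - 2} \<times> {..l}" "b \<in> {..q - 2} \<times> {..M - 2} \<times> {..l}"
      "wt a = wt b"
    then show "a = b" using q_ge_2 M_ge_3
      by (cases a; cases b) (simp only:, intro wt_inj_reduced, auto)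
  qed
  show "wt a \<le> l * (q * M) + ((q ^ N + 1) * (q - 2) + q ^ 3 * (M - 2))"
    if a_in: "a \<in> {..q - 2} \<times> {..M - 2} \<times> {..l}" for a
  proof -
    obtain i j \<kappa> where a: "a = (i, j, \<kappa>)" "i \<le> q - 2" "j \<le> M - 2" "\<kappa> \<le> l" using a_in by (cases a) auto
    have "(q + 1) * M = q ^ N + 1" using M_mult by (simp add: mult.commute)
    then have "wt a = i * (q ^ N + 1) + j * q ^ 3 + \<kappa> * (q * M)" by (simp only: a wt.simps)
    also have "\<dots> \<le> (q - 2) * (q ^ N + 1) + (M - 2) * q ^ 3 + l * (q * M)"
      using a by (intro add_mono mult_right_mono) auto
    finally show ?thesis by (simp add: ac_simps)
  qed
  show "(\<Sum>a\<in>{..q - 2} \<times> {..M - 2} \<times> {..l}. c a * mono_on_set Z a P) = 0" for P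
    using zero[of P] by (cases "P \<in> Z") (simp_all add: mono_on_set_def[OF Z])
qed (use nz in auto)

end

section \<open>The code\<close>

lemma sum_indicator_mult:
  fixes f :: "'i \<Rightarrow> 'a::semiring_1"
  assumes "finite I" "a \<in> I"
  shows "(\<Sum>b\<in>I. (if b = a then 1 else 0) * f b) = f a"
proof -
  have "(\<Sum>b\<in>I. (if b = a then 1 else 0) * f b) = (\<Sum>b\<in>I. if b = a then f a else 0)"
    by (intro sum.cong) auto
  then show ?thesis using assms by simp
qed

text \<open>Coefficients are attached to indices, so \<open>g\<close> may repeat values.\<close>

lemma mem_span_image_iff:
  fixes g :: "'i \<Rightarrow> 'b \<Rightarrow> 'a::field"
  assumes "finite I"
  shows "f \<in> fun_vs.span (g ` I) \<longleftrightarrow> (\<exists>c. f = (\<lambda>P. \<Sum>a\<in>I. c a * g a P))"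
proof
  let ?S = "{f. \<exists>c. f = (\<lambda>P. \<Sum>a\<in>I. c a * g a P)}"
  have "fun_vs.subspace ?S"
  proof (rule fun_vs.subspaceI)
    show "0 \<in> ?S" by (auto intro!: exI[of _ "\<lambda>_. 0"])
  next
    fix f f' assume "f \<in> ?S" "f' \<in> ?S"
    then obtain c c' where "f = (\<lambda>P. \<Sum>a\<in>I. c a * g a P)" "f' = (\<lambda>P. \<Sum>a\<in>I. c' a * g a P)" by auto
    then have "f + f' = (\<lambda>P. \<Sum>a\<in>I. (c a + c' a) * g a P)"
      by (auto simp: fun_eq_iff sum.distrib distrib_right)
    then show "f + f' \<in> ?S" by (auto intro: exI[of _ "\<lambda>a. c a + c' a"])
  next
    fix b f assume "f \<in> ?S"
    then obtain c where "f = (\<lambda>P. \<Sum>a\<in>I. c a * g a P)" by auto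
    then have "(\<lambda>P. b * f P) = (\<lambda>P. \<Sum>a\<in>I. (b * c a) * g a P)"
      by (auto simp: sum_distrib_left mult.assoc)
    then show "(\<lambda>P. b * f P) \<in> ?S" by (auto intro: exI[of _ "\<lambda>a. b * c a"])
  qed
  moreover have "g ` I \<subseteq> ?S"
  proof (rule image_subsetI)
    fix a assume "a \<in> I"
    then have "g a = (\<lambda>P. \<Sum>b\<in>I. (if b = a then 1 else 0) * g b P)"
      by (simp only: sum_indicator_mult[OF assms])
    then show "g a \<in> ?S" 
      unfolding mem_Collect_eq by (rule exI[of _ "\<lambda>b. if b = a then 1 else 0"])
  qed
  ultimately have "fun_vs.span (g ` I) \<subseteq> ?S" by (intro fun_vs.span_minimal)
  then show "\<exists>c. f = (\<lambda>P. \<Sum>a\<in>I. c a * g a P)" if "f \<in> fun_vs.span (g ` I)"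
    using that by blast
next
  assume "\<exists>c. f = (\<lambda>P. \<Sum>a\<in>I. c a * g a P)"
  then obtain c where "f = (\<lambda>P. \<Sum>a\<in>I. c a * g a P)" ..
  then have "f = (\<Sum>a\<in>I. (\<lambda>P. c a * g a P))" by (simp add: fun_eq_iff sum_fun_apply)
  then show "f \<in> fun_vs.span (g ` I)"
    by (simp only:) (intro fun_vs.span_sum fun_vs.span_scale fun_vs.span_base imageI)
qed

text \<open>A nonzero coefficient family has at most \<open>w < n\<close> zeros, so evaluation is
  injective, which gives the dimension. Applied to differences of codewords the same bound gives the
  distance.\<close>

lemma evaluation_code:
  fixes g :: "'i \<Rightarrow> nat \<Rightarrow> 'a::field"
  assumes I: "finite I" "I \<noteq> {}"
    and zeros: "\<And>c. \<exists>a\<in>I. c a \<noteq> 0 \<Longrightarrow> card {i. i < n \<and> (\<Sum>a\<in>I. c a * g a i) = 0} \<le> w"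
    and "w < n"
    and C: "C = range (\<lambda>c. vec n (\<lambda>i. \<Sum>a\<in>I. c a * g a i))"
  shows "linear_code n (card I) (min_distance C) C" and "n - w \<le> min_distance C"
proof -
  interpret vec_space "TYPE('a)" n .
  have indep: "c a = 0" if "\<And>i. i < n \<Longrightarrow> (\<Sum>a\<in>I. c a * g a i) = 0" "a \<in> I" for c a
  proof (rule ccontr)
    assume "c a \<noteq> 0"
    with that(2) have "card {i. i < n \<and> (\<Sum>a\<in>I. c a * g a i) = 0} \<le> w" by (intro zeros) auto
    moreover have "{i. i < n \<and> (\<Sum>a\<in>I. c a * g a i) = 0} = {..<n}" using that(1) by auto
    ultimately show False using \<open>w < n\<close> by simp
  qed
  define v where "v a = vec n (g a)" for a
  have inj: "inj_on v I"
  proof (rule inj_onI, rule ccontr)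
    fix a b assume ab: "a \<in> I" "b \<in> I" "v a = v b" "a \<noteq> b"
    \<comment> \<open>The difference of the indicators of \<open>a\<close> and \<open>b\<close>
      would vanish at every position if \<open>v a = v b\<close>.\<close>
    define c where "c x = (if x = a then 1 else 0) - (if x = b then (1::'a) else 0)" for x
    have "c a = 0"
    proof (rule indep)
      fix i assume "i < n"
      then have "g a i = g b i" using ab(3) unfolding v_def by (metis index_vec)
      moreover have "(\<Sum>x\<in>I. c x * g x i) = g a i - g b i"
        unfolding c_def left_diff_distrib sum_subtractf
        by (simp only: sum_indicator_mult[OF I(1)] ab(1,2))
      ultimately show "(\<Sum>x\<in>I. c x * g x i) = 0" by simp
    qed (rule ab(1))
    then show False using ab(4) by (simp add: c_def)
  qed
  have vI: "v ` I \<subseteq> carrier_vec n" by (auto simp: v_def)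
  have comb: "lincomb u (v ` I) = vec n (\<lambda>i. \<Sum>a\<in>I. u (v a) * g a i)" for u
  proof (rule eq_vecI)
    show "dim_vec (lincomb u (v ` I)) = dim_vec (vec n (\<lambda>i. \<Sum>a\<in>I. u (v a) * g a i))"
      using lincomb_dim[OF _ vI] I(1) by simp
    fix i assume "i < dim_vec (vec n (\<lambda>i. \<Sum>a\<in>I. u (v a) * g a i))"
    then have i: "i < n" by simp
    show "lincomb u (v ` I) $ i = vec n (\<lambda>i. \<Sum>a\<in>I. u (v a) * g a i) $ i"
      using i by (simp add: lincomb_index[OF i vI] sum.reindex[OF inj]) (simp add: v_def)
  qed
  have li: "lin_indpt (v ` I)"
  proof (rule finite_lin_indpt2)
    fix u assume "lincomb u (v ` I) = 0\<^sub>v n"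
    then have eq: "vec n (\<lambda>i. \<Sum>a\<in>I. u (v a) * g a i) = 0\<^sub>v n" by (simp only: comb)
    have "(\<Sum>a\<in>I. u (v a) * g a i) = 0" if "i < n" for i
      using arg_cong[OF eq, of "\<lambda>x. x $ i"] that by simp
    then show "\<forall>x\<in>v ` I. u x = 0" using indep[of "\<lambda>a. u (v a)"] by blast
  qed (use I vI in auto)
  have span: "span (v ` I) = C"
  proof -
    have "span (v ` I) = {lincomb u (v ` I) |u. u \<in> v ` I \<rightarrow> UNIV}"
      using finite_span[of "v ` I"] vI I(1) by simp
    also have "\<dots> = C"
    proof (intro equalityI subsetI)
      fix x assume "x \<in> {lincomb u (v ` I) |u. u \<in> v ` I \<rightarrow> UNIV}"
      then obtain u where "x = lincomb u (v ` I)" by blast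
      then show "x \<in> C" unfolding C comb by (rule range_eqI[of _ _ "\<lambda>a. u (v a)"])
    next
      fix x assume "x \<in> C"
      then obtain c where x: "x = vec n (\<lambda>i. \<Sum>a\<in>I. c a * g a i)" unfolding C by blast
      \<comment> \<open>Injectivity of \<open>v\<close> transports coefficients from indices to
        vectors.\<close>
      let ?u = "\<lambda>y. c (the_inv_into I v y)"
      have "(\<Sum>a\<in>I. ?u (v a) * g a i) = (\<Sum>a\<in>I. c a * g a i)" for i
        by (intro sum.cong) (simp_all add: the_inv_into_f_f[OF inj])
      then have "x = lincomb ?u (v ` I)" unfolding comb x by simp
      then show "x \<in> {lincomb u (v ` I) |u. u \<in> v ` I \<rightarrow> UNIV}" by blast
    qed
    finally show ?thesis .
  qed
  have "subspace class_ring C V"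
    using span_is_subspace[of "v ` I"] vI unfolding span by simp
  moreover have "vectorspace.dim class_ring (V\<lparr>carrier := C\<rparr>) = card I"
  proof -
    have "maximal (v ` I) (\<lambda>T. T \<subseteq> v ` I \<and> lin_indpt T)"
      unfolding maximal_def using li by auto
    then have "vectorspace.dim class_ring (vs (span (v ` I))) = card (v ` I)"
      using vI I(1) by (intro dim_span) auto
    then show ?thesis unfolding span by (simp add: card_image[OF inj])
  qed
  ultimately show "linear_code n (card I) (min_distance C) C"
    unfolding linear_code_def by simp
  have dist: "n - w \<le> hamming_dist x y" if xy: "x \<in> C" "y \<in> C" "x \<noteq> y" for x y
  proof -
    obtain c c' where x: "x = vec n (\<lambda>i. \<Sum>a\<in>I. c a * g a i)" and y: "y = vec n (\<lambda>i. \<Sum>a\<in>I. c' a * g a i)"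
      using xy(1,2) unfolding C by blast
    let ?O = "{i. i < n \<and> (\<Sum>a\<in>I. (c a - c' a) * g a i) = 0}"
    have "\<exists>a\<in>I. c a - c' a \<noteq> 0"
      using xy(3) unfolding x y by (metis (no_types, lifting) right_minus_eq sum.cong)
    then have "card ?O \<le> w" by (rule zeros)
    moreover have "{i. i < dim_vec x \<and> x $ i \<noteq> y $ i} = {..<n} - ?O"
      by (auto simp: x y left_diff_distrib sum_subtractf)
    then have "hamming_dist x y = n - card ?O"
      unfolding hamming_dist_def by (simp add: card_Diff_subset subset_iff)
    ultimately show ?thesis by simp
  qed
  \<comment> \<open>Zero and some \<open>v a\<close> are distinct codewords, so the infimum is
    attained and is not the default value 0 of the empty set.\<close>
  have "v ` I \<subseteq> C" using in_own_span[of "v ` I"] vI span by simp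
  moreover have "0\<^sub>v n \<in> C"
    unfolding C by (rule range_eqI[of _ _ "\<lambda>_. 0"]) auto
  moreover obtain a where "a \<in> I" using I by auto
  moreover have "(UNIV::'a set) \<noteq> {0}" using one_neq_zero by blast
  then have "0\<^sub>v n \<notin> v ` I" using zero_nin_lin_indpt[of "v ` I"] vI li by simp
  then have "v a \<noteq> 0\<^sub>v n" using \<open>a \<in> I\<close> by (metis image_eqI)
  ultimately have "{hamming_dist x y |x y. x \<in> C \<and> y \<in> C \<and> x \<noteq> y} \<noteq> {}" by blast
  then have "min_distance C \<in> {hamming_dist x y |x y. x \<in> C \<and> y \<in> C \<and> x \<noteq> y}"
    unfolding min_distance_def by (rule Inf_nat_def1)
  then show "n - w \<le> min_distance C" using dist by auto
qed

text \<open>\<open>\<phi>\<close> may read the entry off any codeword with the given restriction to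
  \<open>A\<close>.\<close>

lemma recoversI:
  assumes "\<And>c c'. c \<in> C \<Longrightarrow> c' \<in> C \<Longrightarrow> (\<And>j. j \<in> A \<Longrightarrow> c $ j = c' $ j) \<Longrightarrow> c $ i = c' $ i"
  shows "recovers C i A"
proof -
  define \<phi> where "\<phi> r = (SOME c. c \<in> C \<and> restrict (\<lambda>j. c $ j) A = r) $ i" for r
  have "c $ i = \<phi> (restrict (\<lambda>j. c $ j) A)" if "c \<in> C" for c
  proof -
    let ?c' = "SOME c'. c' \<in> C \<and> restrict (\<lambda>j. c' $ j) A = restrict (\<lambda>j. c $ j) A"
    have c': "?c' \<in> C \<and> restrict (\<lambda>j. ?c' $ j) A = restrict (\<lambda>j. c $ j) A"
      by (rule someI[of _ c]) (use that in simp)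
    have "c $ i = ?c' $ i"
    proof (rule assms)
      show "c $ j = ?c' $ j" if "j \<in> A" for j
        using fun_cong[OF conjunct2[OF c'], of j] that by simp
    qed (use that c' in auto)
    then show ?thesis by (simp add: \<phi>_def)
  qed
  then show ?thesis unfolding recovers_def by blast
qed

lemma poly_eq_0_if_card_gt:
  fixes p :: "'a::idom poly"
  assumes "degree p < card S" "\<And>x. x \<in> S \<Longrightarrow> poly p x = 0"
  shows "p = 0"
proof (rule ccontr)
  assume "p \<noteq> 0"
  then have "card S \<le> card {x. poly p x = 0}"
    using assms(2) by (intro card_mono poly_roots_finite) auto
  with card_poly_roots_bound[OF \<open>p \<noteq> 0\<close>] assms(1) show False by simp
qed

section \<open>Recovery sets, dimension and distance on the curve\<close>

context gk_field
begin

abbreviation exps :: "nat \<Rightarrow> (nat \<times> nat \<times> nat) set" where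
  "exps l \<equiv> {..q - 2} \<times> {..M - 2} \<times> {..l}"

lemma gk_code_eq:
  "gk_code q N l n Q = range (\<lambda>c. vec n (\<lambda>i. \<Sum>a\<in>exps l. c a * gk_mono a (Q i :: 'a \<times> 'a \<times> 'a)))"
proof -
  have "(\<lambda>(x, y, z). x ^ i * z ^ j * y ^ \<kappa>) = (gk_mono (i, j, \<kappa>) :: 'a \<times> 'a \<times> 'a \<Rightarrow> 'a)" for i j \<kappa>
    by auto
  then have "{(\<lambda>(x, y, z). x ^ i * z ^ j * y ^ \<kappa>) | i j \<kappa>. i \<le> q - 2 \<and> j \<le> M - 2 \<and> \<kappa> \<le> l}
      = (gk_mono ` exps l :: ('a \<times> 'a \<times> 'a \<Rightarrow> 'a) set)"
    by (auto simp: image_iff)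
  then have "f \<in> gk_space q N l \<longleftrightarrow> (\<exists>c. f = (\<lambda>P. \<Sum>a\<in>exps l. c a * gk_mono a P))"
    for f :: "'a \<times> 'a \<times> 'a \<Rightarrow> 'a"
    unfolding gk_space_def gk_exp_eq by (simp only: mem_span_image_iff finite_cartesian_product finite_atMost)
  then show ?thesis unfolding gk_code_def by (auto simp: image_iff)
qed

lemma gk_poly_x:
  fixes c :: "nat \<times> nat \<times> nat \<Rightarrow> 'a"
  obtains p where "degree p \<le> q - 2" "\<And>x. poly p x = (\<Sum>a\<in>exps l. c a * gk_mono a (x, y, z))"
proof
  let ?p = "\<Sum>(i, j, \<kappa>)\<in>exps l. monom (c (i, j, \<kappa>) * z ^ j * y ^ \<kappa>) i"
  show "degree ?p \<le> q - 2"
    by (rule degree_sum_le) (auto intro: order.trans[OF degree_monom_le])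
  show "poly ?p x = (\<Sum>a\<in>exps l. c a * gk_mono a (x, y, z))" for x
    unfolding poly_sum by (rule sum.cong) (auto simp: poly_monom)
qed

lemma gk_poly_z:
  fixes c :: "nat \<times> nat \<times> nat \<Rightarrow> 'a"
  obtains p where "degree p \<le> M - 2" "\<And>z. poly p z = (\<Sum>a\<in>exps l. c a * gk_mono a (x, y, z))"
proof
  let ?p = "\<Sum>(i, j, \<kappa>)\<in>exps l. monom (c (i, j, \<kappa>) * x ^ i * y ^ \<kappa>) j"
  show "degree ?p \<le> M - 2"
    by (rule degree_sum_le) (auto intro: order.trans[OF degree_monom_le])
  show "poly ?p z = (\<Sum>a\<in>exps l. c a * gk_mono a (x, y, z))" for z
    unfolding poly_sum by (rule sum.cong) (auto simp: poly_monom)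
qed

text \<open>Each set is in bijection with the other roots of one fibre equation, and the codeword is
  there a polynomial of degree less than their number.\<close>

lemma gk_recovery_pair:
  fixes Q :: "nat \<Rightarrow> 'a \<times> 'a \<times> 'a"
  assumes Q: "bij_betw Q {..<n} (gk_points q N)" and i: "i < n"
  shows "recovery_pair n (gk_code q N l n Q) (q - 1) (M - 1) i
       {j. j < n \<and> j \<noteq> i \<and> snd (Q j) = snd (Q i)}
       {j. j < n \<and> j \<noteq> i \<and> fst (Q j) = fst (Q i) \<and> fst (snd (Q j)) = fst (snd (Q i))}"
    (is "recovery_pair n ?C _ _ i ?A1 ?A2")
proof -
  obtain x0 y0 z0 where Qi: "Q i = (x0, y0, z0)" by (cases "Q i")
  have inj: "j = j'" if "j < n" "j' < n" "Q j = Q j'" for j j'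
    using Q that by (auto simp: bij_betw_def inj_on_def)
  have surj: "\<exists>j<n. Q j = P" if "P \<in> gk_points q N" for P
    using Q that unfolding bij_betw_def by (metis imageE lessThan_iff)
  have mem: "Q j \<in> gk_points q N" if "j < n" for j
    using Q that by (auto simp: bij_betw_def)
  have P0: "y0 ^ (q\<^sup>2) - y0 \<in> good" "x0 ^ q + x0 = y0 ^ (q + 1)" "y0 ^ (q\<^sup>2) - y0 = z0 ^ M"
    using mem[OF i] unfolding Qi gk_points_iff by auto
  let ?X = "{x. x ^ q + x = y0 ^ (q + 1)} - {x0}" and ?Y = "{z. y0 ^ (q\<^sup>2) - y0 = z ^ M} - {z0}"
  have bij1: "bij_betw (\<lambda>j. fst (Q j)) ?A1 ?X"
  proof (rule bij_betw_imageI)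
    show "inj_on (\<lambda>j. fst (Q j)) ?A1"
      by (rule inj_onI) (auto intro!: inj prod_eqI)
    show "(\<lambda>j. fst (Q j)) ` ?A1 = ?X"
    proof (intro equalityI subsetI)
      fix x assume "x \<in> (\<lambda>j. fst (Q j)) ` ?A1"
      then obtain j where "j \<in> ?A1" "x = fst (Q j)" by blast
      then have j: "j < n" "j \<noteq> i" "Q j = (x, y0, z0)"
        using Qi by (simp_all add: prod_eq_iff)
      then show "x \<in> ?X"
        using mem[OF j(1)] inj[OF j(1) i] Qi unfolding j(3) gk_points_iff by auto
    next
      fix x assume x: "x \<in> ?X"
      then have "(x, y0, z0) \<in> gk_points q N" using P0 by (simp add: gk_points_iff)
      then obtain j where "j < n" "Q j = (x, y0, z0)" using surj by blast
      with x Qi show "x \<in> (\<lambda>j. fst (Q j)) ` ?A1"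
        by (intro image_eqI[of _ _ j]) auto
    qed
  qed
  have bij2: "bij_betw (\<lambda>j. snd (snd (Q j))) ?A2 ?Y"
  proof (rule bij_betw_imageI)
    show "inj_on (\<lambda>j. snd (snd (Q j))) ?A2"
      by (rule inj_onI) (auto intro!: inj prod_eqI)
    show "(\<lambda>j. snd (snd (Q j))) ` ?A2 = ?Y"
    proof (intro equalityI subsetI)
      fix z assume "z \<in> (\<lambda>j. snd (snd (Q j))) ` ?A2"
      then obtain j where "j \<in> ?A2" "z = snd (snd (Q j))" by blast
      then have j: "j < n" "j \<noteq> i" "Q j = (x0, y0, z)"
        using Qi by (simp_all add: prod_eq_iff)
      then show "z \<in> ?Y"
        using mem[OF j(1)] inj[OF j(1) i] Qi unfolding j(3) gk_points_iff by auto
    next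
      fix z assume z: "z \<in> ?Y"
      then have "(x0, y0, z) \<in> gk_points q N" using P0 by (simp add: gk_points_iff)
      then obtain j where "j < n" "Q j = (x0, y0, z)" using surj by blast
      with z Qi show "z \<in> (\<lambda>j. snd (snd (Q j))) ` ?A2"
        by (intro image_eqI[of _ _ j]) auto
    qed
  qed
  have cX: "card ?X = q - 1" and cY: "card ?Y = M - 1"
    using card_x_fibre[OF P0(1)] card_z_fibre[OF P0(1)] P0(2,3) by (auto simp: card_Diff_singleton)
  have val: "\<exists>c. u = vec n (\<lambda>i. \<Sum>a\<in>exps l. c a * gk_mono a (Q i))" if "u \<in> ?C" for u
    using that unfolding gk_code_eq by blast
  have rec1: "recovers ?C i ?A1"
  proof (rule recoversI)
    fix u u' assume uC: "u \<in> ?C" "u' \<in> ?C" and agree: "\<And>j. j \<in> ?A1 \<Longrightarrow> u $ j = u' $ j"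
    obtain c where u: "u = vec n (\<lambda>i. \<Sum>a\<in>exps l. c a * gk_mono a (Q i))"
      using val[OF uC(1)] by blast
    obtain c' where u': "u' = vec n (\<lambda>i. \<Sum>a\<in>exps l. c' a * gk_mono a (Q i))"
      using val[OF uC(2)] by blast
    obtain p where p: "degree p \<le> q - 2" "\<And>x. poly p x = (\<Sum>a\<in>exps l. c a * gk_mono a (x, y0, z0))"
      by (rule gk_poly_x[where l = l and c = c and y = y0 and z = z0]) blast
    obtain p' where p': "degree p' \<le> q - 2" "\<And>x. poly p' x = (\<Sum>a\<in>exps l. c' a * gk_mono a (x, y0, z0))"
      by (rule gk_poly_x[where l = l and c = c' and y = y0 and z = z0]) blast
    \<comment> \<open>Degree at most \<open>q - 2\<close> against \<open>q - 1\<close> points of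
      agreement.\<close>
    have "p - p' = 0"
    proof (rule poly_eq_0_if_card_gt)
      have "degree (p - p') \<le> q - 2" using p(1) p'(1) by (rule degree_diff_le)
      then show "degree (p - p') < card ?X" using cX q_ge_2 by simp
      fix x assume "x \<in> ?X"
      then obtain j where j: "j \<in> ?A1" "x = fst (Q j)" using bij1 unfolding bij_betw_def by blast
      then have "Q j = (x, y0, z0)" using Qi by (simp add: prod_eq_iff)
      with agree[OF j(1)] j(1) show "poly (p - p') x = 0" by (simp add: p p' u u')
    qed
    then have "poly p x0 = poly p' x0" by simp
    then show "u $ i = u' $ i" using i Qi by (simp add: p p' u u')
  qed
  have rec2: "recovers ?C i ?A2"
  proof (rule recoversI)
    fix u u' assume uC: "u \<in> ?C" "u' \<in> ?C" and agree: "\<And>j. j \<in> ?A2 \<Longrightarrow> u $ j = u' $ j"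
    obtain c where u: "u = vec n (\<lambda>i. \<Sum>a\<in>exps l. c a * gk_mono a (Q i))"
      using val[OF uC(1)] by blast
    obtain c' where u': "u' = vec n (\<lambda>i. \<Sum>a\<in>exps l. c' a * gk_mono a (Q i))"
      using val[OF uC(2)] by blast
    obtain p where p: "degree p \<le> M - 2" "\<And>z. poly p z = (\<Sum>a\<in>exps l. c a * gk_mono a (x0, y0, z))"
      by (rule gk_poly_z[where l = l and c = c and x = x0 and y = y0]) blast
    obtain p' where p': "degree p' \<le> M - 2" "\<And>z. poly p' z = (\<Sum>a\<in>exps l. c' a * gk_mono a (x0, y0, z))"
      by (rule gk_poly_z[where l = l and c = c' and x = x0 and y = y0]) blast
    \<comment> \<open>Degree at most \<open>M - 2\<close> against \<open>M - 1\<close> points of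
      agreement.\<close>
    have "p - p' = 0"
    proof (rule poly_eq_0_if_card_gt)
      have "degree (p - p') \<le> M - 2" using p(1) p'(1) by (rule degree_diff_le)
      then show "degree (p - p') < card ?Y" using cY M_ge_3 by simp
      fix z assume "z \<in> ?Y"
      then obtain j where j: "j \<in> ?A2" "z = snd (snd (Q j))" using bij2 unfolding bij_betw_def by blast
      then have "Q j = (x0, y0, z)" using Qi by (simp add: prod_eq_iff)
      with agree[OF j(1)] j(1) show "poly (p - p') z = 0" by (simp add: p p' u u')
    qed
    then have "poly p z0 = poly p' z0" by simp
    then show "u $ i = u' $ i" using i Qi by (simp add: p p' u u')
  qed
  \<comment> \<open>A common position would share all three coordinates with
    \<open>Q i\<close>.\<close>
  have "?A1 \<inter> ?A2 = {}"
    using inj[OF _ i, unfolded prod_eq_iff] by auto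
  then show ?thesis
    unfolding recovery_pair_def
    using rec1 rec2 bij_betw_same_card[OF bij1] bij_betw_same_card[OF bij2] cX cY by auto
qed

text \<open>The enumeration \<open>Q\<close> transports the zero bound from points to
  positions.\<close>

lemma gk_linear_code:
  fixes Q :: "nat \<Rightarrow> 'a \<times> 'a \<times> 'a"
  assumes Q: "bij_betw Q {..<n} (gk_points q N)"
    and w: "w = l * (q * M) + ((q ^ N + 1) * (q - 2) + q ^ 3 * (M - 2))" "w < n"
  shows "linear_code n ((M - 1) * (q - 1) * (l + 1)) (min_distance (gk_code q N l n Q)) (gk_code q N l n Q)"
    and "n - w \<le> min_distance (gk_code q N l n Q)"
proof -
  have zeros: "card {i. i < n \<and> (\<Sum>a\<in>exps l. c a * gk_mono a (Q i)) = 0} \<le> w"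
    if "\<exists>a\<in>exps l. c a \<noteq> 0" for c
  proof -
    let ?O = "{i. i < n \<and> (\<Sum>a\<in>exps l. c a * gk_mono a (Q i)) = 0}"
    have "?O \<subseteq> {..<n}" by auto
    then have "inj_on Q ?O" "Q ` ?O \<subseteq> gk_points q N"
      using Q unfolding bij_betw_def by (auto intro: inj_on_subset)
    then have "card (Q ` ?O) \<le> w"
      unfolding w(1) by (intro gk_zero_bound[OF _ that]) auto
    then show ?thesis using card_image[OF \<open>inj_on Q ?O\<close>] by simp
  qed
  note code = evaluation_code[OF _ _ zeros w(2) gk_code_eq]
  have "Suc (q - 2) = q - 1" "Suc (M - 2) = M - 1" using q_ge_2 M_ge_3 by auto
  then have "card (exps l) = (M - 1) * (q - 1) * (l + 1)"
    by (simp only: card_cartesian_product card_atMost Suc_eq_plus1[of l] ac_simps)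
  then show "linear_code n ((M - 1) * (q - 1) * (l + 1)) (min_distance (gk_code q N l n Q)) (gk_code q N l n Q)"
    using code(1) by simp
  show "n - w \<le> min_distance (gk_code q N l n Q)"
    using code(2) by simp
qed

end

section \<open>Characteristic, exact division and assembly\<close>

lemma CHAR_eq_prime:
  assumes "prime p" "CARD('a::{field,finite}) = p ^ m"
  shows "CHAR('a) = p"
proof -
  have "prime CHAR('a)"
    using prime_CHAR_semidom[where 'a='a] finite_imp_CHAR_pos[where 'a='a] by simp
  \<comment> \<open>Translation by 1 permutes the field, so the field order is 0 in the
    field.\<close>
  moreover have "(\<Sum>x\<in>(UNIV::'a set). x + 1) = (\<Sum>x\<in>UNIV. x)"
    by (rule sum.reindex_bij_witness[of _ "\<lambda>x. x - 1" "\<lambda>x. x + 1"]) auto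
  then have "of_nat CARD('a) = (0::'a)" by (simp add: sum.distrib)
  then have "CHAR('a) dvd p ^ m"
    using assms(2) by (simp only: of_nat_eq_0_iff_char_dvd)
  ultimately show ?thesis
    using assms(1) by (metis prime_dvd_power primes_dvd_imp_eq)
qed

text \<open>Induction in steps of two; the integers allow the subtraction of a multiple of
  \<open>q + 1\<close>.\<close>

lemma gk_exp_mult:
  assumes "odd N"
  shows "gk_exp q N * (q + 1) = q ^ N + 1"
proof -
  obtain m where "N = 2 * m + 1" using assms by (rule oddE)
  moreover have "int (q + 1) dvd int (q ^ (2 * m + 1) + 1)" for m
  proof (induction m)
    case (Suc m)
    have "int (q ^ (2 * Suc m + 1) + 1) =
        int q ^ 2 * int (q ^ (2 * m + 1) + 1) - int (q + 1) * (int q - 1)"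
      by (simp add: algebra_simps power2_eq_square)
    then show ?case using Suc by (simp only: dvd_diff dvd_mult dvd_triv_left)
  qed simp
  ultimately have "q + 1 dvd q ^ N + 1" by (simp only: of_nat_dvd_iff)
  then show ?thesis unfolding gk_exp_def by (rule dvd_div_mult_self)
qed

theorem theorem5p1:
  fixes p q e N l n k M :: nat
    and Q :: "nat \<Rightarrow> 'a::{field,finite} \<times> 'a \<times> 'a"
    and C :: "'a vec set"
    and D :: int
  assumes "prime p" and "e \<ge> 1" and "q = p ^ e"
    and "N \<ge> 3" and "odd N"
    and "CARD('a) = q ^ (2 * N)"
    and "bij_betw Q {..<n} (gk_points q N)"
    and "l \<ge> 1"
    and "int l < int q ^ (N + 2) + int q ^ (N + 1) - int q - 1"
    and "M = gk_exp q N"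
    and "C = gk_code q N l n Q"
    and "k = (M - 1) * (q - 1) * (l + 1)"
    and "0 < k" and "k < n"
    and "D = int n - int l * (int q * int M)
           - ((int q ^ N + 1) * (int q - 2) + int q ^ 3 * (int M - 2))"
    and "D > 0"
  shows "int n = int q ^ (2 * N + 2) - int q ^ (N + 3) + int q ^ (N + 2) - int q ^ 3 \<and>
    (\<exists>d. linear_code n k d C \<and> int d \<ge> D) \<and>
    availability_2_locality n C (q - 1) (M - 1) \<and>
    (\<forall>i<n. recovery_pair n C (q - 1) (M - 1) i
       {j. j < n \<and> j \<noteq> i \<and> snd (Q j) = snd (Q i)}
       {j. j < n \<and> j \<noteq> i \<and> fst (Q j) = fst (Q i) \<and> fst (snd (Q j)) = fst (snd (Q i))})"
proof -
  have char: "CHAR('a) = p"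
    using \<open>prime p\<close> by (rule CHAR_eq_prime[where m = "e * (2 * N)"])
      (simp only: assms(3,6) power_mult)
  interpret gk_field q N M "TYPE('a)"
  proof
    show "q \<ge> 2"
      using prime_ge_2_nat[OF \<open>prime p\<close>] \<open>e \<ge> 1\<close> self_le_power[of p e] \<open>q = p ^ e\<close> by simp
    show "(a + b) ^ q = a ^ q + b ^ q" for a b :: 'a
      by (rule freshmans_dream'[where n = e]) (simp_all add: char assms(1,3))
    show "M * (q + 1) = q ^ N + 1"
      unfolding \<open>M = gk_exp q N\<close> by (rule gk_exp_mult[OF \<open>odd N\<close>])
  qed (fact assms)+
  have "n = card (gk_points q N :: ('a \<times> 'a \<times> 'a) set)"
    using bij_betw_same_card[OF assms(7)] by simp
  then have n: "int n = int q ^ (2 * N + 2) - int q ^ (N + 3) + int q ^ (N + 2) - int q ^ 3"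
    using card_gk_points_int by simp
  define w where "w = l * (q * M) + ((q ^ N + 1) * (q - 2) + q ^ 3 * (M - 2))"
  \<comment> \<open>The natural subtractions in \<open>w\<close> are exact since
    \<open>q \<ge> 2\<close> and \<open>M \<ge> 3\<close>.\<close>
  have D: "D = int n - int w"
    unfolding w_def assms(15) using q_ge_2 M_ge_3 by (simp add: of_nat_diff distrib_right)
  then have "w < n" using \<open>D > 0\<close> by simp
  note code = gk_linear_code[OF assms(7) w_def \<open>w < n\<close>, folded assms(11,12)]
  have "int (min_distance C) \<ge> D" using code(2) \<open>w < n\<close> unfolding D by linarith
  moreover have rec: "\<forall>i<n. recovery_pair n C (q - 1) (M - 1) i
       {j. j < n \<and> j \<noteq> i \<and> snd (Q j) = snd (Q i)}
       {j. j < n \<and> j \<noteq> i \<and> fst (Q j) = fst (Q i) \<and> fst (snd (Q j)) = fst (snd (Q i))}"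
    using gk_recovery_pair[OF assms(7)] unfolding assms(11) by blast
  ultimately show ?thesis
    using n code(1) unfolding availability_2_locality_def by blast
qed

end
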